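(* Let $\theta>0$, let $z$ be a random variable uniformly distributed on $\mathbb{T}=\{w\in\mathbb{C}:|w|=1\}$, and let $x\in\mathbb{T}$ be not a root of unity, i.e. $x^m\neq 1$ for all $m\in\mathbb{Z}\setminus\{0\}$. For each $n\geq 1$ let $\sigma\in S_n$ be distributed according to the Ewens distribution with parameter $\theta$, and let $\log(Z_{n,z}(x))$ be the random variable defined in the context. Then, as $n\to\infty$, $$\frac{\mathrm{Re}\left(\log (Z_{n,z}(x))\right)}{\sqrt{\frac{\pi^2}{12}\theta\log n}}\stackrel{d}{\longrightarrow} N_R\qquad\text{and}\qquad \frac{\mathrm{Im}\left(\log (Z_{n,z}(x))\right)}{\sqrt{\frac{\pi^2}{12}\theta\log n}}\stackrel{d}{\longrightarrow} N_I,$$ where $N_R\sim\mathcal{N}(0,1)$ and $N_I\sim\mathcal{N}(0,1)$.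
   Context: Ewens distribution with parameter $\theta>0$ on the symmetric group $S_n$: $\mathbb{P}_\theta[\sigma]=\frac{\theta^{l_\sigma}}{\theta(\theta+1)\cdots(\theta+n-1)}$, where $l_\sigma$ is the total number of cycles of $\sigma$. $C_m=C_m(\sigma)$ denotes the number of cycles of length $m$ in $\sigma$. For a $\mathbb{T}$-valued random variable $z$, let $(T_{m,k})_{m,k\geq1}$ be a family of independent random variables, independent of $\sigma$, such that $T_{m,k}\stackrel{d}{=}\prod_{j=1}^m z_j$ with $z_1,\dots,z_m$ i.i.d. copies of $z$. For $x\in\mathbb{T}$ set $$\log(Z_{n,z}(x)):=\sum_{m=1}^n\sum_{k=1}^{C_m}\log(1-x^{-m}T_{m,k}),$$ where $\log$ on the right is the principal branch, with $\log(-y)=\log y+i\pi$ for $y>0$. (The argument $0$ occurs only with probability $0$. The quantity is a choice of logarithm of $\det(I-x^{-1}M)$, where $M_{ij}=z_i\delta_{i,\sigma(j)}$ with i.i.d. $z_i\stackrel{d}{=}z$.) *)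

theory Defs
  imports "HOL-Probability.Probability" "HOL-Combinatorics.Orbits"
begin

text \<open>
  The symmetric group on n letters is \<^term>\<open>{p. p permutes {1..n}}\<close>. The cycles of p are its
  orbits on \<^term>\<open>{1..n}\<close>, fixed points included.
\<close>

definition perm_cycles :: "nat \<Rightarrow> (nat \<Rightarrow> nat) \<Rightarrow> nat set set" where
  "perm_cycles n p = orbit p ` {1..n}"

definition num_cycles :: "nat \<Rightarrow> (nat \<Rightarrow> nat) \<Rightarrow> nat" where
  "num_cycles n p = card (perm_cycles n p)"

definition num_cycles_of_length :: "nat \<Rightarrow> nat \<Rightarrow> (nat \<Rightarrow> nat) \<Rightarrow> nat" where
  "num_cycles_of_length n m p = card {c \<in> perm_cycles n p. card c = m}"

text \<open>The denominator \<^term>\<open>pochhammer \<theta> n\<close> is the rising product of n factors starting at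
  \<^term>\<open>\<theta>\<close>.\<close>

definition ewens_measure :: "real \<Rightarrow> nat \<Rightarrow> (nat \<Rightarrow> nat) measure" where
  "ewens_measure \<theta> n =
     point_measure {p. p permutes {1..n}} (\<lambda>p. ennreal (\<theta> ^ num_cycles n p / pochhammer \<theta> n))"

text \<open>Normalised arc length on the unit circle, as a measure on the complex plane.\<close>

definition uniform_circle :: "complex measure" where
  "uniform_circle = distr (uniform_measure lborel {0..2 * pi}) borel cis"

text \<open>The law of a product of m independent variables, each of law \<^term>\<open>\<mu>\<close>.\<close>

definition iid_prod_law :: "nat \<Rightarrow> complex measure \<Rightarrow> complex measure" where
  "iid_prod_law m \<mu> = distr (Pi\<^sub>M {1..m} (\<lambda>_. \<mu>)) borel (\<lambda>w. \<Prod>j\<in>{1..m}. w j)"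

text \<open>
  Library independence of random variables requires a common value type. For variables of
  different types we ask that the sigma-algebras they generate be independent.
\<close>

definition indep_rv :: "'a measure \<Rightarrow> 'b measure \<Rightarrow> ('a \<Rightarrow> 'b) \<Rightarrow> 'c measure \<Rightarrow> ('a \<Rightarrow> 'c) \<Rightarrow> bool" where
  "indep_rv M S X R Y \<longleftrightarrow> X \<in> measurable M S \<and> Y \<in> measurable M R \<and>
     prob_space.indep_set M (sets (vimage_algebra (space M) X S)) (sets (vimage_algebra (space M) Y R))"

text \<open>
  The logarithm of the characteristic polynomial at x, for the permutation p and a realisation t
  of the family T. The library's \<^const>\<open>Ln\<close> is the principal branch with imaginary
  part in \<open>(-\<pi>, \<pi>]\<close>, so that \<open>Ln (- y) = ln y + \<i> \<pi>\<close> for \<open>y > 0\<close>.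
\<close>

definition log_Z :: "nat \<Rightarrow> complex \<Rightarrow> (nat \<Rightarrow> nat) \<Rightarrow> (nat \<Rightarrow> nat \<Rightarrow> complex) \<Rightarrow> complex" where
  "log_Z n x p t =
     (\<Sum>m\<in>{1..n}. \<Sum>k\<in>{1..num_cycles_of_length n m p}. Ln (1 - x powi (- int m) * t m k))"

end

theory Submission
  imports Defs "HOL-Complex_Analysis.Complex_Analysis"
begin

text \<open>
  Why the theorem holds. For uniform \<open>z\<close> each \<open>T m k\<close> is again uniform on the circle
  (\<open>iid_prod_law_uniform_circle\<close>), and so is its product with the fixed power of \<open>x\<close>
  (\<open>distr_uniform_circle_rotate\<close>). The cycle lengths thus disappear from the problem:
  \<open>log_Z\<close> is a sum of \<open>K\<close> independent copies of \<open>Ln (1 - u)\<close>, where \<open>u\<close> is uniform and \<open>K\<close>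
  is the number of cycles, independent of the summands.

  Let \<open>\<phi>\<close> be the real or the imaginary part, and let \<open>f\<close> be the characteristic function of
  \<open>\<phi> (Ln (1 - u))\<close>. Conditioning on the permutation, the characteristic function of
  \<open>\<phi> (log_Z)\<close> at \<open>t\<close> is the mean of \<open>f(t) ^ K\<close>. The cycle generating function of the symmetric
  group is a rising factorial (\<open>sum_power_card_orbits\<close>), so this mean equals
  \<open>pochhammer (\<theta> f(t)) n / pochhammer \<theta> n\<close> exactly (\<open>char_log_Z_component\<close>). Such a quotient
  converges to \<open>exp c\<close> as soon as \<open>\<theta> (f(t) - 1) ln n \<longlonglongrightarrow> c\<close> (\<open>pochhammer_quotient_tendsto\<close>).
  After rescaling \<open>t\<close> this holds with \<open>c = - t\<^sup>2 / 2\<close> by the second order expansion of \<open>f\<close> at 0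
  (\<open>char_second_order_tendsto\<close>), and the continuity theorem of Levy concludes.

  It remains to know the first two moments of \<open>\<phi> (Ln (1 - u))\<close>, which are \<open>0\<close> and
  \<open>pi\<^sup>2 / 12\<close> in both cases. The imaginary part is linear in the angle and its second moment
  is elementary. For the real part, \<open>ln (norm (1 - u))\<close>, no integral is computed: since
  \<open>Ln (1 - u)\<close> is holomorphic in the disc and vanishes at its centre, the mean of its square
  is 0, so that both parts have the same second moment (\<open>Ln_1_minus_moments\<close>).
\<close>

section \<open>Counting permutations by their number of cycles\<close>

lemma orbit_subset_carrier:
  assumes "p permutes S" "c \<in> S"
  shows "orbit p c \<subseteq> S"
proof
  fix y assume "y \<in> orbit p c"
  then show "y \<in> S"
    using assms by induction (auto simp: permutes_in_image)
qed

text \<open>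
  Composing a permutation of \<open>S\<close> with the transposition of a new point \<open>a\<close> and
  a point \<open>b\<close> of \<open>S\<close> splices \<open>a\<close> into the cycle of \<open>b\<close>, immediately before \<open>b\<close>. This is how
  a permutation of \<open>insert a S\<close> that moves \<open>a\<close> arises from one of \<open>S\<close>, and it changes
  no cycle but that of \<open>b\<close>.
\<close>
lemma orbit_transpose_insert:
  assumes p: "p permutes S" and a: "a \<notin> S" and c: "c \<in> S"
  shows "orbit (Transposition.transpose a b \<circ> p) c = (if b \<in> orbit p c then insert a (orbit p c) else orbit p c)"
    (is "orbit ?q c = ?R")
proof
  have pS: "p y \<in> S" if "y \<in> S" for y
    using p that by (simp add: permutes_in_image)
  have pa: "p a = a"
    using p a by (simp add: permutes_not_in)
  have q: "?q y = (if p y = b then a else p y)" if "y \<in> S" for y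
    using pS[OF that] a by (auto simp: Transposition.transpose_def)
  have qa: "?q a = b"
    using pa by (simp add: Transposition.transpose_def)
  note orb = orbit_subset_carrier[OF p c]
  show "orbit ?q c \<subseteq> ?R"
  proof
    fix y assume "y \<in> orbit ?q c"
    then show "y \<in> ?R"
    proof induction
      case base
      have "p c \<in> orbit p c" by (rule orbit.base)
      then show ?case unfolding q[OF c] by auto
    next
      case (step y)
      show ?case
      proof (cases "y = a")
        case True
        with step.IH orb a have "b \<in> orbit p c"
          by (auto split: if_splits)
        with True qa show ?thesis by auto
      next
        case False
        with step.IH have y: "y \<in> orbit p c" by (auto split: if_splits)
        with orb have "y \<in> S" by auto
        moreover have "p y \<in> orbit p c" using y by (rule orbit.step)
        ultimately show ?thesis using q by auto
      qed
    qed
  qed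
  \<comment> \<open>One step of \<open>p\<close> is one step of \<open>?q\<close>, or two steps with a stop at \<open>a\<close>.\<close>
  have qp: "p y \<in> orbit ?q c \<and> (p y = b \<longrightarrow> a \<in> orbit ?q c)"
    if "?q y \<in> orbit ?q c" "y \<in> S" for y
  proof (cases "p y = b")
    case True
    then have "a \<in> orbit ?q c" using that q by auto
    then show ?thesis using orbit.step[of a ?q c] qa True by auto
  next
    case False
    then show ?thesis using that q by auto
  qed
  have "y \<in> orbit ?q c \<and> (y = b \<longrightarrow> a \<in> orbit ?q c)" if "y \<in> orbit p c" for y
    using that
  proof induction
    case base
    show ?case by (rule qp[OF orbit.base c])
  next
    case (step y)
    then show ?case using orb by (intro qp orbit.step) auto
  qed
  then show "?R \<subseteq> orbit ?q c" by auto
qed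

lemma card_orbits_transpose_insert:
  assumes p: "p permutes S" and S: "finite S" and a: "a \<notin> S" and b: "b \<in> insert a S"
  shows "card (orbit (Transposition.transpose a b \<circ> p) ` insert a S) =
    (if b = a then Suc (card (orbit p ` S)) else card (orbit p ` S))"
proof (cases "b = a")
  case True
  have pa: "p a = a"
    using p a by (simp add: permutes_not_in)
  have "y = a" if "y \<in> orbit p a" for y
    using that by induction (auto simp: pa)
  then have "orbit p a = {a}" using orbit_nonempty[of p a] by auto
  moreover have "{a} \<notin> orbit p ` S"
    using orbit_subset_carrier[OF p] a by blast
  ultimately show ?thesis using True S by simp
next
  case False
  with b have bS: "b \<in> S" by auto
  let ?q = "Transposition.transpose a b \<circ> p"
  let ?g = "\<lambda>X. if b \<in> X then insert a X else X"
  have q: "?q permutes insert a S"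
    using p bS by (intro permutes_compose permutes_swap_id) (auto intro: permutes_subset)
  have pa: "p a = a"
    using p a by (simp add: permutes_not_in)
  have eq: "orbit ?q c = ?g (orbit p c)" if "c \<in> S" for c
    using orbit_transpose_insert[OF p a that, of b] by simp
  have "permutation ?q" using q S permutation_permutes by blast
  then have "orbit ?q (?q a) = orbit ?q a" by (rule permutation_orbit_step)
  moreover have "?q a = b" using pa by (simp add: Transposition.transpose_def)
  ultimately have "orbit ?q b = orbit ?q a" by (rule subst[rotated])
  then have "orbit ?q a \<in> orbit ?q ` S" using imageI[OF bS, of "orbit ?q"] by (rule subst)
  then have "orbit ?q ` insert a S = orbit ?q ` S" by auto
  also have "\<dots> = ?g ` (orbit p ` S)"
    unfolding image_image by (intro image_cong refl eq)
  also have "card \<dots> = card (orbit p ` S)"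
  proof (rule card_image, rule inj_on_inverseI[where g = "\<lambda>X. X - {a}"])
    fix X assume "X \<in> orbit p ` S"
    then show "?g X - {a} = X" using orbit_subset_carrier[OF p] a by auto
  qed
  finally show ?thesis using False by simp
qed

text \<open>
  The generating function of the number of cycles. A permutation of \<open>insert a S\<close> is
  obtained uniquely from one of \<open>S\<close>, either by making \<open>a\<close> a new fixed point, which gains a
  factor \<open>u\<close>, or by inserting \<open>a\<close> before one of the \<open>card S\<close> points, which leaves the number
  of cycles unchanged. Each new point therefore multiplies the sum by \<open>u + card S\<close>.
\<close>
lemma sum_power_card_orbits:
  fixes u :: "'a :: comm_ring_1"
  assumes "finite S"
  shows "(\<Sum>p | p permutes S. u ^ card (orbit p ` S)) = pochhammer u (card S)"
  using assms
proof induction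
  case empty
  have "{p. p permutes ({} :: 'b set)} = {id}" by auto
  then show ?case by simp
next
  case (insert a S)
  let ?F = "\<lambda>T p. u ^ card (orbit p ` T)"
  have "(\<Sum>p | p permutes insert a S. ?F (insert a S) p) =
      (\<Sum>b\<in>insert a S. \<Sum>p | p permutes S. ?F (insert a S) (Transposition.transpose a b \<circ> p))"
    by (rule sum_over_permutations_insert[OF insert.hyps])
  also have "\<dots> = (\<Sum>b\<in>insert a S. \<Sum>p | p permutes S. (if b = a then u else 1) * ?F S p)"
  proof (intro sum.cong refl)
    fix b p assume "b \<in> insert a S" "p \<in> {p. p permutes S}"
    then have "card (orbit (Transposition.transpose a b \<circ> p) ` insert a S) =
        (if b = a then Suc (card (orbit p ` S)) else card (orbit p ` S))"
      using insert.hyps by (intro card_orbits_transpose_insert) auto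
    then show "?F (insert a S) (Transposition.transpose a b \<circ> p) = (if b = a then u else 1) * ?F S p"
      by (simp del: image_insert)
  qed
  also have "\<dots> = (\<Sum>b\<in>insert a S. if b = a then u else 1) * (\<Sum>p | p permutes S. ?F S p)"
    by (rule sum_product[symmetric])
  also have "(\<Sum>b\<in>insert a S. if b = a then u else 1) = u + of_nat (card S)"
  proof -
    have "(\<Sum>b\<in>S. if b = a then u else 1) = (\<Sum>b\<in>S. 1)"
      using insert.hyps by (intro sum.cong) auto
    then show ?thesis using insert.hyps by simp
  qed
  finally show ?case
    using insert by (simp add: pochhammer_Suc mult.commute)
qed

section \<open>Asymptotics of a quotient of rising factorials\<close>

text \<open>
  With \<open>\<delta> = w n - \<theta>\<close> the quotient is the product of the factors \<open>1 + \<delta> / (\<theta> + j)\<close> for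
  \<open>j < n\<close>. Its logarithm is \<open>\<delta>\<close> times a harmonic sum, hence \<open>\<delta> ln n\<close> up to \<open>O(\<delta>)\<close>, with a
  quadratic error that vanishes because \<open>\<delta> = O(1 / ln n)\<close>.
\<close>
lemma pochhammer_quotient_tendsto:
  fixes \<theta> :: real and w :: "nat \<Rightarrow> complex"
  assumes \<theta>: "\<theta> > 0" and w: "(\<lambda>n. (w n - of_real \<theta>) * of_real (ln (real n))) \<longlonglongrightarrow> c"
  shows "(\<lambda>n. pochhammer (w n) n / pochhammer (of_real \<theta>) n) \<longlonglongrightarrow> exp c"
proof -
  define \<delta> where "\<delta> n = w n - of_real \<theta>" for n
  define a where "a j = inverse (\<theta> + real j)" for j
  define H where "H n = (\<Sum>j<n. a j)" for n
  have a: "0 < a j" "a j \<le> 1 / \<theta>" for j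
    using \<theta> by (auto simp: a_def field_simps add_pos_nonneg)
  have H0: "0 \<le> H n" for n
    unfolding H_def by (intro sum_nonneg less_imp_le a)
  have lnlim: "filterlim (\<lambda>n. ln (real n)) at_top sequentially"
    by (rule filterlim_compose[OF ln_at_top filterlim_real_sequentially])
  have inv0: "(\<lambda>n. complex_of_real (inverse (ln (real n)))) \<longlonglongrightarrow> of_real 0"
    by (intro tendsto_of_real tendsto_inverse_0_at_top lnlim)
  have "(\<lambda>n. \<delta> n * of_real (ln (real n)) * of_real (inverse (ln (real n)))) \<longlonglongrightarrow> c * of_real 0"
    using w inv0 unfolding \<delta>_def by (rule tendsto_mult)
  moreover have "eventually (\<lambda>n. \<delta> n * of_real (ln (real n)) * of_real (inverse (ln (real n))) = \<delta> n) sequentially"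
    using eventually_gt_at_top[of 1] by eventually_elim (simp add: field_simps)
  ultimately have "\<delta> \<longlonglongrightarrow> c * of_real 0"
    by (rule Lim_transform_eventually)
  then have \<delta>0: "\<delta> \<longlonglongrightarrow> 0" by simp
  have dig: "(\<lambda>n. ln (real n) - H n) \<longlonglongrightarrow> Digamma \<theta>"
    using Digamma_LIMSEQ[of \<theta>] \<theta> unfolding H_def a_def by simp
  have "(\<lambda>n. \<delta> n * of_real (ln (real n)) - \<delta> n * of_real (ln (real n) - H n)) \<longlonglongrightarrow> c - 0 * of_real (Digamma \<theta>)"
    using w dig \<delta>0 unfolding \<delta>_def by (intro tendsto_intros)
  then have \<delta>H: "(\<lambda>n. \<delta> n * of_real (H n)) \<longlonglongrightarrow> c"
    by (simp add: algebra_simps)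
  define L where "L n = (\<Sum>j<n. Ln (1 + \<delta> n * of_real (a j)))" for n
  \<comment> \<open>This threshold puts every \<open>\<delta> / (\<theta> + j)\<close> into the disc of radius 1/2, where \<open>Ln (1 + y)\<close> is \<open>y\<close> up to \<open>2 * norm y ^ 2\<close>.\<close>
  have small: "eventually (\<lambda>n. norm (\<delta> n) < \<theta> / 2) sequentially"
    using tendstoD[OF \<delta>0, of "\<theta> / 2"] \<theta> by (simp add: dist_norm)
  have bound: "norm (\<delta> n * of_real (a j)) < 1 / 2" if "norm (\<delta> n) < \<theta> / 2" for n j
  proof -
    have "norm (\<delta> n) * a j < \<theta> / 2 * (1 / \<theta>)"
      using that a \<theta> by (intro mult_less_le_imp_less) auto
    then show ?thesis using \<theta> a[of j] by (simp add: norm_mult)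
  qed
  have "(\<lambda>n. L n - \<delta> n * of_real (H n)) \<longlonglongrightarrow> 0"
  proof (rule Lim_null_comparison)
    show "eventually (\<lambda>n. norm (L n - \<delta> n * of_real (H n)) \<le> 2 / \<theta> * norm (\<delta> n) * norm (\<delta> n * of_real (H n))) sequentially"
      using small
    proof eventually_elim
      case (elim n)
      have "norm (L n - \<delta> n * of_real (H n)) = norm (\<Sum>j<n. Ln (1 + \<delta> n * of_real (a j)) - \<delta> n * of_real (a j))"
        unfolding L_def H_def by (simp add: sum_subtractf sum_distrib_left)
      also have "\<dots> \<le> (\<Sum>j<n. 2 / \<theta> * (norm (\<delta> n))\<^sup>2 * a j)"
      proof (rule sum_norm_le)
        fix j
        let ?y = "\<delta> n * of_real (a j)"
        have y: "norm ?y < 1 / 2" by (rule bound[OF elim])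
        have "norm (Ln (1 + ?y) - ?y) \<le> (norm ?y)\<^sup>2 / (1 - norm ?y)"
          using y by (intro Ln_approx_linear) auto
        also have "\<dots> \<le> (norm ?y)\<^sup>2 / (1 / 2)"
          using y by (intro divide_left_mono) auto
        also have "\<dots> = 2 * (norm (\<delta> n))\<^sup>2 * a j * a j"
          using a[of j] by (simp add: norm_mult power2_eq_square)
        also have "\<dots> \<le> 2 * (norm (\<delta> n))\<^sup>2 * a j * (1 / \<theta>)"
          using a[of j] by (intro mult_left_mono) auto
        finally show "norm (Ln (1 + ?y) - ?y) \<le> 2 / \<theta> * (norm (\<delta> n))\<^sup>2 * a j"
          by (simp add: mult_ac)
      qed
      also have "\<dots> = 2 / \<theta> * norm (\<delta> n) * norm (\<delta> n * of_real (H n))"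
      proof -
        have "(\<Sum>j<n. 2 / \<theta> * (norm (\<delta> n))\<^sup>2 * a j) = 2 / \<theta> * (norm (\<delta> n))\<^sup>2 * H n"
          by (simp add: H_def sum_distrib_left)
        then show ?thesis
          using H0[of n] by (simp add: norm_mult power2_eq_square)
      qed
      finally show ?case .
    qed
    have "(\<lambda>n. 2 / \<theta> * norm (\<delta> n) * norm (\<delta> n * of_real (H n))) \<longlonglongrightarrow> 2 / \<theta> * norm (0::complex) * norm c"
      by (intro tendsto_intros \<delta>0 \<delta>H)
    then show "(\<lambda>n. 2 / \<theta> * norm (\<delta> n) * norm (\<delta> n * of_real (H n))) \<longlonglongrightarrow> 0" by simp
  qed
  from tendsto_add[OF this \<delta>H] have "(\<lambda>n. exp (L n)) \<longlonglongrightarrow> exp c"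
    by (auto intro: tendsto_exp)
  moreover have "eventually (\<lambda>n. exp (L n) = pochhammer (w n) n / pochhammer (of_real \<theta>) n) sequentially"
    using small
  proof eventually_elim
    case (elim n)
    have "1 + \<delta> n * of_real (a j) \<noteq> 0" for j
      using bound[OF elim, of j] by (auto simp: add_eq_0_iff)
    then have "exp (L n) = (\<Prod>j<n. 1 + \<delta> n * of_real (a j))"
      unfolding L_def by (subst exp_sum) auto
    also have "\<dots> = (\<Prod>j<n. (w n + of_nat j) / (of_real \<theta> + of_nat j))"
    proof (rule prod.cong[OF refl])
      fix j
      have "complex_of_real (\<theta> + real j) \<noteq> 0"
        using \<theta> by (subst of_real_eq_0_iff) (auto simp: add_pos_nonneg dest: less_imp_neq)
      then show "1 + \<delta> n * of_real (a j) = (w n + of_nat j) / (of_real \<theta> + of_nat j)"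
        by (simp add: \<delta>_def a_def field_simps)
    qed
    also have "\<dots> = pochhammer (w n) n / pochhammer (of_real \<theta>) n"
      by (simp add: pochhammer_prod prod_dividef atLeast0LessThan)
    finally show ?case .
  qed
  ultimately show ?thesis by (rule Lim_transform_eventually)
qed

section \<open>The uniform law on the circle\<close>

lemma measurable_cis [measurable]: "cis \<in> borel_measurable borel"
  by (intro borel_measurable_continuous_onI continuous_intros)

lemma sets_uniform_circle [measurable_cong, simp]: "sets uniform_circle = sets borel"
  by (simp add: uniform_circle_def)

lemma space_uniform_circle [simp]: "space uniform_circle = UNIV"
  by (simp add: uniform_circle_def)

lemma prob_space_uniform_circle: "prob_space uniform_circle"
proof -
  interpret prob_space "uniform_measure lborel {0..2 * pi}"
    by (rule prob_space_uniform_measure) (use pi_gt_zero in \<open>auto simp: ennreal_eq_0_iff not_le\<close>)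
  show ?thesis unfolding uniform_circle_def by (rule prob_space_distr) simp
qed

interpretation UC: prob_space uniform_circle
  by (rule prob_space_uniform_circle)

lemma AE_uniform_circle_norm: "AE u in uniform_circle. norm u = 1"
  unfolding uniform_circle_def by (subst AE_distr_iff) auto

lemma AE_uniform_circle_neq_1: "AE u in uniform_circle. u \<noteq> 1"
proof -
  have "AE \<alpha> in lborel. \<alpha> \<in> {0..2 * pi} \<longrightarrow> cis \<alpha> \<noteq> 1"
    using AE_lborel_singleton[of 0] AE_lborel_singleton[of "2 * pi"]
  proof eventually_elim
    case (elim \<alpha>)
    show ?case
    proof
      assume "\<alpha> \<in> {0..2 * pi}"
      then have "sin (\<alpha> / 2) > 0" using elim by (intro sin_gt_zero) auto
      then have "cos \<alpha> \<noteq> 1" using cos_double_sin[of "\<alpha> / 2"] by simp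
      then show "cis \<alpha> \<noteq> 1" by (auto simp: complex_eq_iff)
    qed
  qed
  then show ?thesis
    unfolding uniform_circle_def by (subst AE_distr_iff) (auto intro!: AE_uniform_measureI)
qed

text \<open>
  The half-open interval is the one whose translates can be cut and reassembled exactly
  when the circle is rotated.
\<close>
lemma nn_integral_uniform_circle:
  fixes f :: "complex \<Rightarrow> ennreal"
  assumes [measurable]: "f \<in> borel_measurable borel"
  shows "(\<integral>\<^sup>+u. f u \<partial>uniform_circle) =
    (\<integral>\<^sup>+\<alpha>. f (cis \<alpha>) * indicator {0..<2 * pi} \<alpha> \<partial>lborel) / ennreal (2 * pi)"
proof -
  have "(\<integral>\<^sup>+u. f u \<partial>uniform_circle) = (\<integral>\<^sup>+\<alpha>. f (cis \<alpha>) * indicator {0..2 * pi} \<alpha> \<partial>lborel) / ennreal (2 * pi)"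
    unfolding uniform_circle_def by (simp add: nn_integral_distr nn_integral_uniform_measure)
  also have "(\<integral>\<^sup>+\<alpha>. f (cis \<alpha>) * indicator {0..2 * pi} \<alpha> \<partial>lborel) =
      (\<integral>\<^sup>+\<alpha>. f (cis \<alpha>) * indicator {0..<2 * pi} \<alpha> \<partial>lborel)"
    using AE_lborel_singleton[of "2 * pi"]
    by (intro nn_integral_cong_AE) (auto elim!: eventually_mono split: split_indicator)
  finally show ?thesis .
qed

text \<open>
  A rotation by the angle \<open>\<beta>\<close> translates the interval of integration to
  \<open>[\<beta>, 2 * pi + \<beta>)\<close>; by periodicity the part beyond \<open>2 * pi\<close> can be moved back to \<open>[0, \<beta>)\<close>.
\<close>
lemma nn_integral_uniform_circle_rotate:
  fixes f :: "complex \<Rightarrow> ennreal"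
  assumes [measurable]: "f \<in> borel_measurable borel" and c: "norm c = 1"
  shows "(\<integral>\<^sup>+u. f (c * u) \<partial>uniform_circle) = (\<integral>\<^sup>+u. f u \<partial>uniform_circle)"
proof -
  define \<beta> where "\<beta> = Arg2pi c"
  have \<beta>: "0 \<le> \<beta>" "\<beta> < 2 * pi" and c_eq: "c = cis \<beta>"
    using Arg2pi[of c] c by (auto simp: \<beta>_def is_Arg_def cis_conv_exp)
  define g where "g \<alpha> = f (cis \<alpha>)" for \<alpha>
  have [measurable]: "g \<in> borel_measurable borel" unfolding g_def by measurable
  have per: "g (2 * pi + \<alpha>) = g \<alpha>" for \<alpha>
    by (simp add: g_def cis.code cos_add sin_add)
  have "(\<integral>\<^sup>+\<alpha>. g (\<beta> + \<alpha>) * indicator {0..<2 * pi} \<alpha> \<partial>lborel) =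
      (\<integral>\<^sup>+\<alpha>. g (\<beta> + 1 * \<alpha>) * indicator {\<beta>..<2 * pi + \<beta>} (\<beta> + 1 * \<alpha>) \<partial>lborel)"
    by (intro nn_integral_cong) (auto split: split_indicator)
  also have "\<dots> = (\<integral>\<^sup>+\<alpha>. g \<alpha> * indicator {\<beta>..<2 * pi + \<beta>} \<alpha> \<partial>lborel)"
    by (subst nn_integral_real_affine[where t = \<beta> and c = 1]) auto
  also have "\<dots> = (\<integral>\<^sup>+\<alpha>. g \<alpha> * indicator {\<beta>..<2 * pi} \<alpha> + g \<alpha> * indicator {2 * pi..<2 * pi + \<beta>} \<alpha> \<partial>lborel)"
    using \<beta> by (intro nn_integral_cong) (auto split: split_indicator)
  also have "\<dots> = (\<integral>\<^sup>+\<alpha>. g \<alpha> * indicator {\<beta>..<2 * pi} \<alpha> \<partial>lborel) +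
      (\<integral>\<^sup>+\<alpha>. g \<alpha> * indicator {2 * pi..<2 * pi + \<beta>} \<alpha> \<partial>lborel)"
    by (intro nn_integral_add) auto
  also have "(\<integral>\<^sup>+\<alpha>. g \<alpha> * indicator {2 * pi..<2 * pi + \<beta>} \<alpha> \<partial>lborel) =
      (\<integral>\<^sup>+\<alpha>. g (2 * pi + 1 * \<alpha>) * indicator {2 * pi..<2 * pi + \<beta>} (2 * pi + 1 * \<alpha>) \<partial>lborel)"
    by (subst nn_integral_real_affine[where t = "2 * pi" and c = 1]) auto
  also have "\<dots> = (\<integral>\<^sup>+\<alpha>. g \<alpha> * indicator {0..<\<beta>} \<alpha> \<partial>lborel)"
    by (intro nn_integral_cong) (auto simp: per split: split_indicator)
  also have "(\<integral>\<^sup>+\<alpha>. g \<alpha> * indicator {\<beta>..<2 * pi} \<alpha> \<partial>lborel) + (\<integral>\<^sup>+\<alpha>. g \<alpha> * indicator {0..<\<beta>} \<alpha> \<partial>lborel) =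
      (\<integral>\<^sup>+\<alpha>. g \<alpha> * indicator {\<beta>..<2 * pi} \<alpha> + g \<alpha> * indicator {0..<\<beta>} \<alpha> \<partial>lborel)"
    by (intro nn_integral_add[symmetric]) auto
  also have "\<dots> = (\<integral>\<^sup>+\<alpha>. g \<alpha> * indicator {0..<2 * pi} \<alpha> \<partial>lborel)"
    using \<beta> by (intro nn_integral_cong) (auto split: split_indicator)
  finally show ?thesis
    by (simp add: nn_integral_uniform_circle g_def c_eq cis_mult)
qed

lemma distr_uniform_circle_rotate:
  assumes "norm c = 1"
  shows "distr uniform_circle borel (\<lambda>u. c * u) = uniform_circle"
proof (rule measure_eqI)
  fix A assume "A \<in> sets (distr uniform_circle borel (\<lambda>u. c * u))"
  then have [measurable]: "A \<in> sets borel" by simp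
  have "emeasure (distr uniform_circle borel (\<lambda>u. c * u)) A =
      (\<integral>\<^sup>+u. indicator A u \<partial>distr uniform_circle borel (\<lambda>u. c * u))"
    by simp
  also have "\<dots> = (\<integral>\<^sup>+u. indicator A (c * u) \<partial>uniform_circle)"
    by (rule nn_integral_distr) auto
  also have "\<dots> = (\<integral>\<^sup>+u. indicator A u \<partial>uniform_circle)"
    using assms by (intro nn_integral_uniform_circle_rotate) auto
  finally show "emeasure (distr uniform_circle borel (\<lambda>u. c * u)) A = emeasure uniform_circle A"
    by simp
qed simp

text \<open>
  One uniform factor already makes the product uniform, whatever the other factors are.
  The constant \<open>c\<close> makes the induction go through: fixing the newly inserted coordinate
  \<open>y\<close>, which has norm 1 almost surely, replaces \<open>c\<close> by \<open>c * y\<close>.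
\<close>
lemma nn_integral_prod_uniform_circle:
  fixes f :: "complex \<Rightarrow> ennreal"
  assumes [measurable]: "f \<in> borel_measurable borel"
    and "finite I" "I \<noteq> {}" "norm c = 1"
  shows "(\<integral>\<^sup>+w. f (c * (\<Prod>j\<in>I. w j)) \<partial>Pi\<^sub>M I (\<lambda>_. uniform_circle)) = (\<integral>\<^sup>+u. f u \<partial>uniform_circle)"
proof -
  interpret product_sigma_finite "\<lambda>_. uniform_circle" ..
  show ?thesis
    using assms(2-4)
  proof (induction arbitrary: c rule: finite_ne_induct)
    case (singleton i)
    have "(\<integral>\<^sup>+w. f (c * (\<Prod>j\<in>{i}. w j)) \<partial>Pi\<^sub>M {i} (\<lambda>_. uniform_circle)) = (\<integral>\<^sup>+u. f (c * u) \<partial>uniform_circle)"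
      using product_nn_integral_singleton[of "\<lambda>u. f (c * u)" i] by simp
    then show ?case using singleton nn_integral_uniform_circle_rotate[of f c] by simp
  next
    case (insert i I)
    have "(\<integral>\<^sup>+w. f (c * (\<Prod>j\<in>insert i I. w j)) \<partial>Pi\<^sub>M (insert i I) (\<lambda>_. uniform_circle)) =
        (\<integral>\<^sup>+y. (\<integral>\<^sup>+w. f (c * (\<Prod>j\<in>insert i I. (w(i := y)) j)) \<partial>Pi\<^sub>M I (\<lambda>_. uniform_circle)) \<partial>uniform_circle)"
      using insert.hyps by (intro product_nn_integral_insert_rev) auto
    also have "\<dots> = (\<integral>\<^sup>+y. (\<integral>\<^sup>+w. f (c * y * (\<Prod>j\<in>I. w j)) \<partial>Pi\<^sub>M I (\<lambda>_. uniform_circle)) \<partial>uniform_circle)"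
    proof -
      have "(\<Prod>j\<in>I. (w(i := y)) j) = (\<Prod>j\<in>I. w j)" for w :: "_ \<Rightarrow> complex" and y
        using insert.hyps by (intro prod.cong) auto
      then show ?thesis using insert.hyps by (simp add: mult.assoc)
    qed
    also have "\<dots> = (\<integral>\<^sup>+y. (\<integral>\<^sup>+u. f u \<partial>uniform_circle) \<partial>uniform_circle)"
      using AE_uniform_circle_norm
    proof (intro nn_integral_cong_AE, eventually_elim)
      case (elim y)
      with insert.prems show ?case by (intro insert.IH) (simp add: norm_mult)
    qed
    also have "\<dots> = (\<integral>\<^sup>+u. f u \<partial>uniform_circle)"
      using UC.emeasure_space_1 by simp
    finally show ?case .
  qed
qed

lemma iid_prod_law_uniform_circle:
  assumes "m \<ge> 1"
  shows "iid_prod_law m uniform_circle = uniform_circle"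
proof (rule measure_eqI)
  let ?P = "\<lambda>w :: nat \<Rightarrow> complex. \<Prod>j\<in>{1..m}. w j"
  fix A assume "A \<in> sets (iid_prod_law m uniform_circle)"
  then have [measurable]: "A \<in> sets borel" by (simp add: iid_prod_law_def)
  have "emeasure (iid_prod_law m uniform_circle) A = (\<integral>\<^sup>+u. indicator A u \<partial>iid_prod_law m uniform_circle)"
    by (simp add: iid_prod_law_def)
  also have "\<dots> = (\<integral>\<^sup>+w. indicator A (?P w) \<partial>Pi\<^sub>M {1..m} (\<lambda>_. uniform_circle))"
    unfolding iid_prod_law_def by (rule nn_integral_distr) auto
  also have "\<dots> = (\<integral>\<^sup>+u. indicator A u \<partial>uniform_circle)"
    using nn_integral_prod_uniform_circle[of "indicator A" "{1..m}" 1] assms by simp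
  finally show "emeasure (iid_prod_law m uniform_circle) A = emeasure uniform_circle A"
    by simp
qed (simp add: iid_prod_law_def)

lemma integral_uniform_circle:
  fixes h :: "complex \<Rightarrow> 'a :: {banach, second_countable_topology}"
  assumes [measurable]: "h \<in> borel_measurable borel"
  shows "(LINT u|uniform_circle. h u) = (1 / (2 * pi)) *\<^sub>R (LINT \<alpha>:{0..2 * pi}|lborel. h (cis \<alpha>))"
proof -
  have eq: "uniform_measure lborel {0..2 * pi} =
      density lborel (\<lambda>\<alpha>. ennreal (indicator {0..2 * pi} \<alpha> / (2 * pi)))"
  proof -
    have "1 / ennreal (2 * pi) = ennreal (1 / (2 * pi))"
      using divide_ennreal[of 1 "2 * pi"] by simp
    then show ?thesis
      unfolding uniform_measure_def
      by (intro arg_cong[where f = "density lborel"] ext) (simp split: split_indicator)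
  qed
  have "(LINT u|uniform_circle. h u) = (LINT \<alpha>|uniform_measure lborel {0..2 * pi}. h (cis \<alpha>))"
    unfolding uniform_circle_def by (rule integral_distr) auto
  also have "\<dots> = (LINT \<alpha>|lborel. (indicator {0..2 * pi} \<alpha> / (2 * pi)) *\<^sub>R h (cis \<alpha>))"
    unfolding eq by (rule integral_density) auto
  also have "\<dots> = (LINT \<alpha>|lborel. (1 / (2 * pi)) *\<^sub>R (indicator {0..2 * pi} \<alpha> *\<^sub>R h (cis \<alpha>)))"
    by (intro Bochner_Integration.integral_cong refl) (simp split: split_indicator)
  also have "\<dots> = (1 / (2 * pi)) *\<^sub>R (LINT \<alpha>:{0..2 * pi}|lborel. h (cis \<alpha>))"
    unfolding set_lebesgue_integral_def by (rule integral_scaleR_right)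
  finally show ?thesis .
qed

section \<open>Moments of the logarithm on the circle\<close>

text \<open>
  Follows from \<open>1 - cis \<alpha> = 2 sin (\<alpha> / 2) cis ((\<alpha> - pi) / 2)\<close>, where the argument
  \<open>(\<alpha> - pi) / 2\<close> lies within the principal range.
\<close>
lemma Ln_1_minus_cis:
  assumes "0 < \<alpha>" "\<alpha> < 2 * pi"
  shows "Ln (1 - cis \<alpha>) = of_real (ln (2 * sin (\<alpha> / 2))) + \<i> * of_real ((\<alpha> - pi) / 2)"
proof -
  have s: "sin (\<alpha> / 2) > 0" using assms by (intro sin_gt_zero) auto
  have c: "cis (2 * \<beta>) = Complex (1 - 2 * (sin \<beta>)\<^sup>2) (2 * sin \<beta> * cos \<beta>)" for \<beta>
    by (simp add: cis.code cos_double_sin sin_double)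
  have "1 - cis \<alpha> = of_real (2 * sin (\<alpha> / 2)) * cis ((\<alpha> - pi) / 2)"
    using c[of "\<alpha> / 2"]
    by (simp add: complex_eq_iff diff_divide_distrib cos_diff sin_diff power2_eq_square)
  also have "Ln \<dots> = of_real (ln (2 * sin (\<alpha> / 2))) + Ln (cis ((\<alpha> - pi) / 2))"
    using s by (subst Ln_times_of_real) (auto simp: Ln_of_real simp del: of_real_mult)
  also have "Ln (cis ((\<alpha> - pi) / 2)) = \<i> * of_real ((\<alpha> - pi) / 2)"
    using assms by (subst Ln_cis) auto
  finally show ?thesis .
qed

text \<open>
  The mean value property, which is Cauchy's formula at the centre of the circle of
  radius \<open>r\<close> written in the angular parameter.
\<close>
lemma integral_uniform_circle_holomorphic:
  fixes g :: "complex \<Rightarrow> complex"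
  assumes g: "g holomorphic_on ball 0 1" and r: "0 < r" "r < 1"
    and [measurable]: "g \<in> borel_measurable borel"
  shows "(LINT u|uniform_circle. g (of_real r * u)) = g 0"
proof -
  have sub: "cball 0 r \<subseteq> ball (0::complex) 1" using r by auto
  have "((\<lambda>u. g u / (u - 0)) has_contour_integral 2 * of_real pi * \<i> * g 0) (circlepath 0 r)"
    using r holomorphic_on_subset[OF g sub]
    by (intro Cauchy_integral_circlepath_simple) auto
  then have "((\<lambda>x. 2 * of_real pi * \<i> * g (of_real r * cis (2 * pi * x))) has_integral 2 * of_real pi * \<i> * g 0) {0..1}"
    unfolding has_contour_integral_def
  proof (rule has_integral_eq[rotated])
    fix x :: real assume x: "x \<in> {0..1}"
    have "exp (2 * of_real pi * \<i> * of_real x) = cis (2 * pi * x)"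
      by (simp add: cis_conv_exp mult_ac)
    then show "g (circlepath 0 r x) / (circlepath 0 r x - 0) * vector_derivative (circlepath 0 r) (at x within {0..1}) =
        2 * of_real pi * \<i> * g (of_real r * cis (2 * pi * x))"
      using x r by (simp add: vector_derivative_circlepath01) (simp add: circlepath)
  qed
  from has_integral_mult_right[OF this, of "1 / (2 * of_real pi * \<i>)"]
  have "((\<lambda>x. g (of_real r * cis (2 * pi * x))) has_integral g 0) {0..1}"
    by (simp add: field_simps)
  from has_integral_stretch_real[OF this, of "1 / (2 * pi)"]
  have "((\<lambda>\<alpha>. g (of_real r * cis \<alpha>)) has_integral (2 * pi) *\<^sub>R g 0) ((\<lambda>x. x * (2 * pi)) ` {0..1})"
    by simp
  also have "(\<lambda>x. x * (2 * pi)) ` {0..1::real} = {0..2 * pi}"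
    by (subst image_mult_atLeastAtMost_if') auto
  finally have int: "integral {0..2 * pi} (\<lambda>\<alpha>. g (of_real r * cis \<alpha>)) = (2 * pi) *\<^sub>R g 0"
    by (rule integral_unique)
  have "set_integrable lborel {0..2 * pi} (\<lambda>\<alpha>. g (of_real r * cis \<alpha>))"
    using r by (intro borel_integrable_atLeastAtMost' continuous_on_compose2[OF holomorphic_on_imp_continuous_on[OF g]]
        continuous_intros) (auto simp: norm_mult)
  with int have "(LINT \<alpha>:{0..2 * pi}|lborel. g (of_real r * cis \<alpha>)) = (2 * pi) *\<^sub>R g 0"
    by (simp add: set_borel_integral_eq_integral)
  then show ?thesis
    by (subst integral_uniform_circle) auto
qed

lemma abs_Im_Ln_le_pi: "w \<noteq> 0 \<Longrightarrow> \<bar>Im (Ln w)\<bar> \<le> pi"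
  using Im_Ln_le_pi[of w] mpi_less_Im_Ln[of w] by (simp add: abs_le_iff)

lemma integral_Im_Ln_sq: "(LINT u|uniform_circle. (Im (Ln (1 - u)))\<^sup>2) = pi\<^sup>2 / 12"
proof -
  have "(LINT u|uniform_circle. (Im (Ln (1 - u)))\<^sup>2) =
      (1 / (2 * pi)) *\<^sub>R (LINT \<alpha>:{0..2 * pi}|lborel. (Im (Ln (1 - cis \<alpha>)))\<^sup>2)"
    by (rule integral_uniform_circle) measurable
  also have "(LINT \<alpha>:{0..2 * pi}|lborel. (Im (Ln (1 - cis \<alpha>)))\<^sup>2) = (LINT \<alpha>:{0..2 * pi}|lborel. ((\<alpha> - pi) / 2)\<^sup>2)"
    unfolding set_lebesgue_integral_def
  proof (rule integral_cong_AE)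
    show "AE \<alpha> in lborel. indicator {0..2 * pi} \<alpha> *\<^sub>R (Im (Ln (1 - cis \<alpha>)))\<^sup>2 =
        indicator {0..2 * pi} \<alpha> *\<^sub>R ((\<alpha> - pi) / 2)\<^sup>2"
      using AE_lborel_singleton[of 0] AE_lborel_singleton[of "2 * pi"]
      by eventually_elim (auto simp: Ln_1_minus_cis split: split_indicator)
  qed measurable
  also have "\<dots> = integral {0..2 * pi} (\<lambda>\<alpha>. ((\<alpha> - pi) / 2)\<^sup>2)"
    by (intro set_borel_integral_eq_integral borel_integrable_atLeastAtMost' continuous_intros) auto
  also have "((\<lambda>\<alpha>. ((\<alpha> - pi) / 2)\<^sup>2) has_integral ((2 * pi - pi) ^ 3 / 12 - (0 - pi) ^ 3 / 12)) {0..2 * pi}"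
    by (rule fundamental_theorem_of_calculus)
       (auto intro!: derivative_eq_intros simp: has_real_derivative_iff_has_vector_derivative[symmetric] power2_eq_square field_simps)
  then have "integral {0..2 * pi} (\<lambda>\<alpha>. ((\<alpha> - pi) / 2)\<^sup>2) = (2 * pi - pi) ^ 3 / 12 - (0 - pi) ^ 3 / 12"
    by (rule integral_unique)
  finally show ?thesis by (simp add: power3_eq_cube power2_eq_square field_simps)
qed

text \<open>
  Moving \<open>u\<close> radially inwards by \<open>1 - r\<close> brings it nearer to 1 by at most \<open>1 - r\<close>, and the
  new point is itself at least \<open>1 - r\<close> away from 1.
\<close>
lemma norm_1_minus_le_radial:
  fixes u :: complex
  assumes "norm u = 1" "0 \<le> r" "r < 1"
  shows "norm (1 - u) \<le> 2 * norm (1 - of_real r * u)"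
proof -
  have "1 - u = (1 - of_real r * u) - of_real (1 - r) * u" by (simp add: algebra_simps)
  then have "norm (1 - u) \<le> norm (1 - of_real r * u) + norm (of_real (1 - r) * u)"
    by (metis norm_triangle_ineq4)
  also have "norm (of_real (1 - r) * u) = 1 - r" using assms by (simp add: norm_mult del: of_real_diff)
  also have "1 - r \<le> norm (1 - of_real r * u)"
    using norm_triangle_ineq2[of 1 "of_real r * u"] assms by (simp add: norm_mult)
  finally show ?thesis by simp
qed

text \<open>
  A bound uniform in the radius \<open>r\<close>, which dominates the passage \<open>r \<longlonglongrightarrow> 1\<close> by the boundary
  function itself; the integrability of its singularity at 1 is then all that matters.
\<close>
lemma norm_Ln_radial_le:
  fixes u :: complex
  assumes u: "norm u = 1" "u \<noteq> 1" and r: "0 \<le> r" "r < 1"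
  shows "norm (Ln (1 - of_real r * u)) \<le> \<bar>Re (Ln (1 - u))\<bar> + ln 2 + pi"
proof -
  have pos: "0 < norm (1 - u)" using u by simp
  have *: "norm (1 - u) \<le> 2 * norm (1 - of_real r * u)" by (rule norm_1_minus_le_radial) fact+
  then have pos': "0 < norm (1 - of_real r * u)" using pos by linarith
  have "ln (norm (1 - u)) \<le> ln (2 * norm (1 - of_real r * u))"
    using pos pos' * by simp
  then have low: "ln (norm (1 - u)) - ln 2 \<le> ln (norm (1 - of_real r * u))"
    using pos' by (simp add: ln_mult)
  have "norm (1 - of_real r * u) \<le> 1 + norm (of_real r * u)"
    using norm_triangle_ineq4[of 1 "of_real r * u"] by simp
  also have "\<dots> \<le> 2" using u r by (simp add: norm_mult)
  finally have up: "ln (norm (1 - of_real r * u)) \<le> ln 2" using pos' by simp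
  have "norm (Ln (1 - of_real r * u)) \<le> \<bar>Re (Ln (1 - of_real r * u))\<bar> + \<bar>Im (Ln (1 - of_real r * u))\<bar>"
    by (rule cmod_le)
  also have "\<bar>Re (Ln (1 - of_real r * u))\<bar> \<le> \<bar>Re (Ln (1 - u))\<bar> + ln 2"
  proof -
    have "0 \<le> ln (2::real)" by simp
    moreover have "Re (Ln (1 - of_real r * u)) = ln (norm (1 - of_real r * u))"
      "Re (Ln (1 - u)) = ln (norm (1 - u))"
      using pos pos' by (auto intro!: Re_Ln)
    ultimately show ?thesis using low up by arith
  qed
  also have "\<bar>Im (Ln (1 - of_real r * u))\<bar> \<le> pi" using pos' by (intro abs_Im_Ln_le_pi) auto
  finally show ?thesis by simp
qed

lemma one_minus_notin_nonpos_Reals: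
  fixes u :: complex
  assumes "norm u \<le> 1" "u \<noteq> 1"
  shows "1 - u \<notin> \<real>\<^sub>\<le>\<^sub>0"
proof
  assume "1 - u \<in> \<real>\<^sub>\<le>\<^sub>0"
  then have "Im u = 0" "1 \<le> Re u" by (auto simp: complex_nonpos_Reals_iff)
  moreover have "Re u \<le> 1" using assms complex_Re_le_cmod[of u] by linarith
  ultimately show False using assms by (auto simp: complex_eq_iff)
qed

text \<open>
  On the circle of radius \<open>r < 1\<close> the functions \<open>Ln (1 - u)\<close> and \<open>(Ln (1 - u))\<^sup>2\<close> have
  mean value 0, their value at the centre. The real part of the second statement says that
  \<open>Re (Ln (1 - u))\<close> and \<open>Im (Ln (1 - u))\<close> have the same second moment. The imaginary part is
  bounded by \<open>pi\<close>, so Fatou's lemma yields square integrability of the real part on the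
  unit circle; then dominated convergence as \<open>r \<longlonglongrightarrow> 1\<close> transports both mean values to
  the boundary, and the second moment of the real part follows from the elementary one
  of the imaginary part.
\<close>
lemma Ln_1_minus_moments:
  shows square_integrable_Re_Ln: "integrable uniform_circle (\<lambda>u. (Re (Ln (1 - u)))\<^sup>2)"
    and square_integrable_Im_Ln: "integrable uniform_circle (\<lambda>u. (Im (Ln (1 - u)))\<^sup>2)"
    and integral_Re_Ln: "(LINT u|uniform_circle. Re (Ln (1 - u))) = 0"
    and integral_Im_Ln: "(LINT u|uniform_circle. Im (Ln (1 - u))) = 0"
    and integral_Re_Ln_sq: "(LINT u|uniform_circle. (Re (Ln (1 - u)))\<^sup>2) = pi\<^sup>2 / 12"
proof -
  \<comment> \<open>Any sequence in \<open>(0, 1)\<close> with limit 1 would do.\<close>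
  define r where "r k = real (Suc k) / real (Suc (Suc k))" for k
  have r: "0 < r k" "r k < 1" for k by (auto simp: r_def)
  have r_lim: "r \<longlonglongrightarrow> 1" unfolding r_def by (rule LIMSEQ_Suc[OF LIMSEQ_n_over_Suc_n])
  define F where "F k u = Ln (1 - of_real (r k) * u)" for k u
  let ?f = "\<lambda>u. Ln (1 - u)"
  have [measurable]: "F k \<in> borel_measurable borel" for k unfolding F_def by measurable
  have hol: "?f holomorphic_on ball 0 1"
    by (intro holomorphic_intros one_minus_notin_nonpos_Reals) auto
  have F1: "(LINT u|uniform_circle. F k u) = 0" for k
    using integral_uniform_circle_holomorphic[OF hol r[of k]] by (simp add: F_def)
  have F2: "(LINT u|uniform_circle. (F k u)\<^sup>2) = 0" for k
    using integral_uniform_circle_holomorphic[of "\<lambda>u. (?f u)\<^sup>2", OF _ r[of k]] holomorphic_on_power[OF hol, of 2]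
    by (simp add: F_def)
  have F_bounded: "\<exists>B. \<forall>u. norm u = 1 \<longrightarrow> norm (F k u) \<le> B" for k
  proof -
    have "compact (F k ` sphere 0 1)"
      unfolding F_def
      using r[of k]
      by (intro compact_continuous_image continuous_intros one_minus_notin_nonpos_Reals) 
         (auto simp: norm_mult dest: arg_cong[where f = norm])
    then obtain B where "\<forall>v\<in>F k ` sphere 0 1. norm v \<le> B"
      using compact_imp_bounded bounded_iff by blast
    then show ?thesis by (intro exI[of _ B]) (auto simp: dist_norm)
  qed
  have F_sq: "integrable uniform_circle (\<lambda>u. (F k u)\<^sup>2)" for k
  proof -
    obtain B where "\<And>u. norm u = 1 \<Longrightarrow> norm (F k u) \<le> B" using F_bounded by blast
    with AE_uniform_circle_norm have "AE u in uniform_circle. norm ((F k u)\<^sup>2) \<le> B\<^sup>2"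
      by (auto elim!: eventually_mono simp: norm_power intro!: power_mono)
    then show ?thesis by (rule UC.integrable_const_bound) measurable
  qed
  have Im_bound: "AE u in uniform_circle. norm ((Im (Ln (1 - of_real a * u)))\<^sup>2) \<le> pi\<^sup>2" if "0 < a" "a \<le> 1" for a
    using AE_uniform_circle_norm AE_uniform_circle_neq_1
  proof eventually_elim
    case (elim u)
    have "of_real a * u \<noteq> 1"
    proof
      assume *: "of_real a * u = 1"
      then have "norm (of_real a * u) = 1" by simp
      with elim that have "a = 1" by (simp add: norm_mult)
      with * elim show False by simp
    qed
    then have "\<bar>Im (Ln (1 - of_real a * u))\<bar> \<le> pi" by (intro abs_Im_Ln_le_pi) auto
    then show ?case by (simp add: abs_le_square_iff[symmetric])
  qed
  have Im_sq: "integrable uniform_circle (\<lambda>u. (Im (Ln (1 - of_real a * u)))\<^sup>2)" if "0 < a" "a \<le> 1" for a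
    by (rule UC.integrable_const_bound[OF Im_bound[OF that]]) measurable
  have F_Im_sq: "integrable uniform_circle (\<lambda>u. (Im (F k u))\<^sup>2)" for k
    unfolding F_def using r[of k] by (intro Im_sq) auto
  have Re_sq: "Re (w\<^sup>2) = (Re w)\<^sup>2 - (Im w)\<^sup>2" for w
    by (simp add: power2_eq_square)
  have F_Re_sq: "integrable uniform_circle (\<lambda>u. (Re (F k u))\<^sup>2)"
    and F_Re_Im: "(LINT u|uniform_circle. (Re (F k u))\<^sup>2) = (LINT u|uniform_circle. (Im (F k u))\<^sup>2)" for k
  proof -
    have "integrable uniform_circle (\<lambda>u. Re ((F k u)\<^sup>2) + (Im (F k u))\<^sup>2)"
      using F_sq F_Im_sq by (intro Bochner_Integration.integrable_add) auto
    then show int: "integrable uniform_circle (\<lambda>u. (Re (F k u))\<^sup>2)" by (simp add: Re_sq)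
    have "(LINT u|uniform_circle. Re ((F k u)\<^sup>2)) = 0"
      using F2[of k] integral_Re[OF F_sq[of k]] by simp
    then show "(LINT u|uniform_circle. (Re (F k u))\<^sup>2) = (LINT u|uniform_circle. (Im (F k u))\<^sup>2)"
      using int F_Im_sq[of k] by (simp add: Re_sq)
  qed
  have F_lim: "AE u in uniform_circle. (\<lambda>k. F k u) \<longlonglongrightarrow> ?f u"
    using AE_uniform_circle_norm AE_uniform_circle_neq_1
  proof eventually_elim
    case (elim u)
    have "(\<lambda>k. 1 - of_real (r k) * u) \<longlonglongrightarrow> 1 - of_real 1 * u"
      by (intro tendsto_intros r_lim)
    then show ?case unfolding F_def
      using elim by (intro tendsto_Ln one_minus_notin_nonpos_Reals) auto
  qed
  \<comment> \<open>Fatou's lemma; the bound \<open>pi\<^sup>2\<close> is that of the imaginary parts.\<close>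
  have Re_fin: "(\<integral>\<^sup>+u. ennreal ((Re (?f u))\<^sup>2) \<partial>uniform_circle) \<le> ennreal (pi\<^sup>2)"
  proof -
    have "(\<integral>\<^sup>+u. ennreal ((Re (?f u))\<^sup>2) \<partial>uniform_circle) =
        (\<integral>\<^sup>+u. liminf (\<lambda>k. ennreal ((Re (F k u))\<^sup>2)) \<partial>uniform_circle)"
      using F_lim
    proof (intro nn_integral_cong_AE, eventually_elim)
      case (elim u)
      then have "(\<lambda>k. ennreal ((Re (F k u))\<^sup>2)) \<longlonglongrightarrow> ennreal ((Re (?f u))\<^sup>2)"
        by (intro tendsto_intros tendsto_ennrealI)
      then show ?case using lim_imp_Liminf by (metis sequentially_bot)
    qed
    also have "\<dots> \<le> liminf (\<lambda>k. \<integral>\<^sup>+u. ennreal ((Re (F k u))\<^sup>2) \<partial>uniform_circle)"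
      by (rule nn_integral_liminf) measurable
    also have "\<dots> \<le> liminf (\<lambda>k. ennreal (pi\<^sup>2))"
    proof (intro Liminf_mono always_eventually allI)
      fix k
      have "(\<integral>\<^sup>+u. ennreal ((Re (F k u))\<^sup>2) \<partial>uniform_circle) = ennreal (LINT u|uniform_circle. (Im (F k u))\<^sup>2)"
        using F_Re_sq[of k] by (simp add: nn_integral_eq_integral F_Re_Im)
      also have "(LINT u|uniform_circle. (Im (F k u))\<^sup>2) \<le> (LINT u|uniform_circle. pi\<^sup>2)"
        using F_Im_sq[of k] Im_bound[of "r k"] r[of k] by (intro integral_mono_AE) (auto simp: F_def)
      finally show "(\<integral>\<^sup>+u. ennreal ((Re (F k u))\<^sup>2) \<partial>uniform_circle) \<le> ennreal (pi\<^sup>2)"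
        using UC.prob_space by (simp add: ennreal_leI)
    qed
    also have "\<dots> = ennreal (pi\<^sup>2)" by (simp add: Liminf_const)
    finally show ?thesis .
  qed
  show R2: "integrable uniform_circle (\<lambda>u. (Re (?f u))\<^sup>2)"
    by (rule integrableI_bounded) (use Re_fin in \<open>auto intro: le_less_trans\<close>)
  show I2: "integrable uniform_circle (\<lambda>u. (Im (?f u))\<^sup>2)"
    using Im_sq[of 1] by simp
  have R1: "integrable uniform_circle (\<lambda>u. Re (?f u))"
    using R2 by (rule UC.square_integrable_imp_integrable[rotated]) measurable
  define c where "c = ln 2 + pi"
  \<comment> \<open>The dominating function of \<open>norm_Ln_radial_le\<close>.\<close>
  define W where "W u = \<bar>Re (?f u)\<bar> + c" for u
  have W: "integrable uniform_circle W"
    unfolding W_def using R1 by auto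
  have W2: "integrable uniform_circle (\<lambda>u. (W u)\<^sup>2)"
  proof -
    have "integrable uniform_circle (\<lambda>u. (Re (?f u))\<^sup>2 + (2 * c * \<bar>Re (?f u)\<bar> + c\<^sup>2))"
      using R1 R2 by auto
    moreover have "(W u)\<^sup>2 = (Re (?f u))\<^sup>2 + (2 * c * \<bar>Re (?f u)\<bar> + c\<^sup>2)" for u
      unfolding W_def power2_sum by simp
    ultimately show ?thesis by simp
  qed
  have dom: "AE u in uniform_circle. norm (F k u) \<le> W u" for k
    using AE_uniform_circle_norm AE_uniform_circle_neq_1
  proof eventually_elim
    case (elim u)
    then show ?case using norm_Ln_radial_le[of u "r k"] r[of k] by (simp add: F_def W_def c_def)
  qed
  have f1: "integrable uniform_circle ?f" and f1_lim: "(\<lambda>k. LINT u|uniform_circle. F k u) \<longlonglongrightarrow> (LINT u|uniform_circle. ?f u)"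
    using integrable_dominated_convergence[of ?f uniform_circle F W]
      integral_dominated_convergence[of ?f uniform_circle F W] W F_lim dom by auto
  have f0: "(LINT u|uniform_circle. ?f u) = 0"
    by (rule LIMSEQ_unique[OF f1_lim[unfolded F1] tendsto_const])
  have dom2: "AE u in uniform_circle. norm ((F k u)\<^sup>2) \<le> (W u)\<^sup>2" for k
    using dom[of k] by eventually_elim (auto simp: norm_power intro: power_mono)
  have F2_lim: "AE u in uniform_circle. (\<lambda>k. (F k u)\<^sup>2) \<longlonglongrightarrow> (?f u)\<^sup>2"
    using F_lim by eventually_elim (rule tendsto_power)
  have f2: "integrable uniform_circle (\<lambda>u. (?f u)\<^sup>2)"
    and f2_lim: "(\<lambda>k. LINT u|uniform_circle. (F k u)\<^sup>2) \<longlonglongrightarrow> (LINT u|uniform_circle. (?f u)\<^sup>2)"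
    using integrable_dominated_convergence[of "\<lambda>u. (?f u)\<^sup>2" uniform_circle "\<lambda>k u. (F k u)\<^sup>2" "\<lambda>u. (W u)\<^sup>2"]
      integral_dominated_convergence[of "\<lambda>u. (?f u)\<^sup>2" uniform_circle "\<lambda>k u. (F k u)\<^sup>2" "\<lambda>u. (W u)\<^sup>2"]
      W2 F2_lim dom2 by auto
  have f20: "(LINT u|uniform_circle. (?f u)\<^sup>2) = 0"
    by (rule LIMSEQ_unique[OF f2_lim[unfolded F2] tendsto_const])
  show "(LINT u|uniform_circle. Re (?f u)) = 0"
    using integral_Re[OF f1] f0 by simp
  show "(LINT u|uniform_circle. Im (?f u)) = 0"
    using integral_Im[OF f1] f0 by simp
  have "(LINT u|uniform_circle. Re ((?f u)\<^sup>2)) = 0"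
    using integral_Re[OF f2] f20 by simp
  then have "(LINT u|uniform_circle. (Re (?f u))\<^sup>2) = (LINT u|uniform_circle. (Im (?f u))\<^sup>2)"
    using R2 I2 by (simp add: Re_sq)
  then show "(LINT u|uniform_circle. (Re (?f u))\<^sup>2) = pi\<^sup>2 / 12"
    by (simp add: integral_Im_Ln_sq)
qed

section \<open>Characteristic functions of sums over a random index set\<close>

text \<open>
  The expansion \<open>char \<nu> \<tau> = 1 - v \<tau>\<^sup>2 / 2 + o(\<tau>\<^sup>2)\<close> of a centred law with variance \<open>v\<close>, in a
  form without division by \<open>\<tau>\<^sup>2\<close>, so that \<open>\<tau> = 0\<close> requires no separate treatment.
\<close>
lemma char_second_order_tendsto:
  fixes \<nu> :: "real measure" and \<tau> a :: "nat \<Rightarrow> real"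
  assumes "real_distribution \<nu>" and [simp]: "integrable \<nu> (\<lambda>x. x)" "integrable \<nu> (\<lambda>x. x\<^sup>2)"
    and mean: "(LINT x|\<nu>. x) = 0" and var: "(LINT x|\<nu>. x\<^sup>2) = v"
    and \<tau>: "\<tau> \<longlonglongrightarrow> 0" and a: "(\<lambda>n. a n * (\<tau> n)\<^sup>2) \<longlonglongrightarrow> b"
  shows "(\<lambda>n. (char \<nu> (\<tau> n) - 1) * of_real (a n)) \<longlonglongrightarrow> of_real (- (b * v / 2))"
proof -
  interpret real_distribution \<nu> by fact
  have [measurable_cong]: "sets \<nu> = sets borel" by simp
  define D where "D n = (LINT x|\<nu>. min (6 * x\<^sup>2) (\<bar>\<tau> n\<bar> * \<bar>x\<bar> ^ 3))" for n
  have "(\<lambda>n. LINT x|\<nu>. min (6 * x\<^sup>2) (\<bar>\<tau> n\<bar> * \<bar>x\<bar> ^ 3)) \<longlonglongrightarrow> (LINT x|\<nu>. 0)"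
  proof (rule integral_dominated_convergence[where w = "\<lambda>x. 6 * x\<^sup>2"])
    show "AE x in \<nu>. (\<lambda>n. min (6 * x\<^sup>2) (\<bar>\<tau> n\<bar> * \<bar>x\<bar> ^ 3)) \<longlonglongrightarrow> 0"
    proof (rule AE_I2)
      fix x :: real
      have "(\<lambda>n. min (6 * x\<^sup>2) (\<bar>\<tau> n\<bar> * \<bar>x\<bar> ^ 3)) \<longlonglongrightarrow> min (6 * x\<^sup>2) (\<bar>0\<bar> * \<bar>x\<bar> ^ 3)"
        by (intro tendsto_intros \<tau>)
      then show "(\<lambda>n. min (6 * x\<^sup>2) (\<bar>\<tau> n\<bar> * \<bar>x\<bar> ^ 3)) \<longlonglongrightarrow> 0" by simp
    qed
  qed (auto intro!: AE_I2)
  then have D0: "D \<longlonglongrightarrow> 0" unfolding D_def by simp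
  have approx: "norm (char \<nu> (\<tau> n) - (1 - (\<tau> n)\<^sup>2 * v / 2)) \<le> (\<tau> n)\<^sup>2 / 6 * D n" for n
    unfolding D_def by (rule char_approx3) (simp_all add: mean var)
  have "(\<lambda>n. (char \<nu> (\<tau> n) - 1) * of_real (a n) + of_real (a n * (\<tau> n)\<^sup>2 * v / 2)) \<longlonglongrightarrow> 0"
  proof (rule Lim_null_comparison[OF always_eventually], intro allI)
    fix n
    have "(char \<nu> (\<tau> n) - 1) * of_real (a n) + of_real (a n * (\<tau> n)\<^sup>2 * v / 2) =
        of_real (a n) * (char \<nu> (\<tau> n) - (1 - (\<tau> n)\<^sup>2 * v / 2))"
      by (simp add: algebra_simps)
    then have "norm ((char \<nu> (\<tau> n) - 1) * of_real (a n) + of_real (a n * (\<tau> n)\<^sup>2 * v / 2)) =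
        \<bar>a n\<bar> * norm (char \<nu> (\<tau> n) - (1 - (\<tau> n)\<^sup>2 * v / 2))"
      by (simp only: norm_mult norm_of_real)
    also have "\<dots> \<le> \<bar>a n\<bar> * ((\<tau> n)\<^sup>2 / 6 * D n)"
      by (intro mult_left_mono approx) auto
    also have "\<dots> = \<bar>a n * (\<tau> n)\<^sup>2\<bar> / 6 * D n"
      by (simp add: abs_mult)
    finally show "norm ((char \<nu> (\<tau> n) - 1) * of_real (a n) + of_real (a n * (\<tau> n)\<^sup>2 * v / 2)) \<le>
        \<bar>a n * (\<tau> n)\<^sup>2\<bar> / 6 * D n" .
  next
    have "(\<lambda>n. \<bar>a n * (\<tau> n)\<^sup>2\<bar> / 6 * D n) \<longlonglongrightarrow> \<bar>b\<bar> / 6 * 0"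
      by (intro tendsto_intros a D0) auto
    then show "(\<lambda>n. \<bar>a n * (\<tau> n)\<^sup>2\<bar> / 6 * D n) \<longlonglongrightarrow> 0" by simp
  qed
  moreover have "(\<lambda>n. complex_of_real (a n * (\<tau> n)\<^sup>2 * v / 2)) \<longlonglongrightarrow> of_real (b * v / 2)"
    by (intro tendsto_intros a) auto
  ultimately have "(\<lambda>n. (char \<nu> (\<tau> n) - 1) * of_real (a n) + of_real (a n * (\<tau> n)\<^sup>2 * v / 2)
      - of_real (a n * (\<tau> n)\<^sup>2 * v / 2)) \<longlonglongrightarrow> 0 - of_real (b * v / 2)"
    by (rule tendsto_diff)
  then show ?thesis by simp
qed

lemma (in prob_space) indep_var_compose_indep_rv:
  assumes XY: "indep_rv M S X R Y" and f: "f \<in> measurable S N" and g: "g \<in> measurable R L"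
  shows "indep_var N (\<lambda>\<omega>. f (X \<omega>)) L (\<lambda>\<omega>. g (Y \<omega>))"
proof -
  have X: "X \<in> measurable M S" and Y: "Y \<in> measurable M R"
    and ind: "indep_set (sets (vimage_algebra (space M) X S)) (sets (vimage_algebra (space M) Y R))"
    using XY by (auto simp: indep_rv_def)
  have sub: "sigma_sets (space M) {(\<lambda>\<omega>. h (Z \<omega>)) -` A \<inter> space M | A. A \<in> sets K} \<subseteq> sets (vimage_algebra (space M) Z Q)"
    if Z: "Z \<in> measurable M Q" and h: "h \<in> measurable Q K" for Z Q h K
  proof -
    have "(\<lambda>\<omega>. h (Z \<omega>)) \<in> measurable (vimage_algebra (space M) Z Q) K"
      using Z h by (intro measurable_compose[OF measurable_vimage_algebra1 h]) (auto dest: measurable_space)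
    then have "{(\<lambda>\<omega>. h (Z \<omega>)) -` A \<inter> space M | A. A \<in> sets K} \<subseteq> sets (vimage_algebra (space M) Z Q)"
      by (auto dest: measurable_sets simp: space_vimage_algebra)
    then show ?thesis
      using sets.sigma_sets_subset[of _ "vimage_algebra (space M) Z Q"] by (simp add: space_vimage_algebra)
  qed
  have "indep_set (sigma_sets (space M) {(\<lambda>\<omega>. f (X \<omega>)) -` A \<inter> space M | A. A \<in> sets N})
      (sigma_sets (space M) {(\<lambda>\<omega>. g (Y \<omega>)) -` A \<inter> space M | A. A \<in> sets L})"
    using ind sub[OF X f] sub[OF Y g] unfolding indep_sets2_eq by blast
  then show ?thesis
    unfolding indep_var_eq using measurable_compose[OF X f] measurable_compose[OF Y g] by blast
qed

text \<open>
  Given \<open>\<sigma> = p\<close>, the sum has \<open>card (I p)\<close> independent terms of law \<open>\<nu>\<close>, since \<open>\<sigma>\<close> is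
  independent of the whole family. The lemma is the resulting conditional expectation, written
  as a finite sum over the values of \<open>\<sigma>\<close>.
\<close>
lemma (in prob_space) char_sum_random_index_set:
  fixes T :: "'i \<Rightarrow> 'a \<Rightarrow> 'c :: topological_space" and f :: "'i \<Rightarrow> 'c \<Rightarrow> real"
  assumes S: "finite S"
    and \<sigma>T: "indep_rv M (count_space S) \<sigma> (Pi\<^sub>M J (\<lambda>_. borel)) (\<lambda>\<omega>. \<lambda>i\<in>J. T i \<omega>)"
    and T: "indep_vars (\<lambda>_. borel) T J"
    and f: "\<And>i. i \<in> J \<Longrightarrow> f i \<in> borel_measurable borel"
    and \<nu>: "\<And>i. i \<in> J \<Longrightarrow> distr M borel (\<lambda>\<omega>. f i (T i \<omega>)) = \<nu>"
    and I: "\<And>p. p \<in> S \<Longrightarrow> I p \<subseteq> J"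
  shows "(\<lambda>\<omega>. \<Sum>i\<in>I (\<sigma> \<omega>). f i (T i \<omega>)) \<in> borel_measurable M"
    and "char (distr M borel (\<lambda>\<omega>. \<Sum>i\<in>I (\<sigma> \<omega>). f i (T i \<omega>))) t =
      (\<Sum>p\<in>S. of_real (measure (distr M (count_space S) \<sigma>) {p}) * char \<nu> t ^ card (I p))"
proof -
  have \<sigma>[measurable]: "\<sigma> \<in> measurable M (count_space S)" using \<sigma>T by (simp add: indep_rv_def)
  have T_meas: "T i \<in> borel_measurable M" if "i \<in> J" for i
    using T that by (simp add: indep_vars_def)
  define X where "X p \<omega> = (\<Sum>i\<in>I p. f i (T i \<omega>))" for p \<omega>
  have X_meas: "X p \<in> borel_measurable M" if "p \<in> S" for p
    unfolding X_def using I[OF that] f T_meas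
    by (intro borel_measurable_sum measurable_compose[OF T_meas f]) auto
  show meas: "(\<lambda>\<omega>. \<Sum>i\<in>I (\<sigma> \<omega>). f i (T i \<omega>)) \<in> borel_measurable M"
    by (rule measurable_compose_countable'[OF X_meas[unfolded X_def] \<sigma> countable_finite[OF S]])
  let ?e = "\<lambda>p \<omega>. iexp (t * X p \<omega>)"
  let ?in = "\<lambda>p \<omega>. indicator {p} (\<sigma> \<omega>) :: complex"
  have e_meas: "?e p \<in> borel_measurable M" if "p \<in> S" for p
    using X_meas[OF that] by measurable
  have in_meas: "?in p \<in> borel_measurable M" for p
    by (rule measurable_compose[OF \<sigma>]) simp
  have e_int: "integrable M (?e p)" if "p \<in> S" for p
    using e_meas[OF that] by (intro integrable_const_bound[where B = 1]) (auto simp del: of_real_mult)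
  have in_int: "integrable M (?in p)" for p
    using in_meas by (intro integrable_const_bound[where B = 1]) (auto split: split_indicator)
  have prod_int: "integrable M (\<lambda>\<omega>. ?in p \<omega> * ?e p \<omega>)"
    and prod_eq: "(LINT \<omega>|M. ?in p \<omega> * ?e p \<omega>) = (LINT \<omega>|M. ?in p \<omega>) * (LINT \<omega>|M. ?e p \<omega>)" if p: "p \<in> S" for p
  proof -
    have g: "(\<lambda>w. iexp (t * (\<Sum>i\<in>I p. f i (w i)))) \<in> borel_measurable (Pi\<^sub>M J (\<lambda>_. borel :: 'c measure))"
    proof -
      have "(\<lambda>w. f i (w i)) \<in> borel_measurable (Pi\<^sub>M J (\<lambda>_. borel))" if "i \<in> J" for i
        by (rule measurable_compose[OF measurable_component_singleton[OF that] f[OF that]])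
      then have "(\<lambda>w. \<Sum>i\<in>I p. f i (w i)) \<in> borel_measurable (Pi\<^sub>M J (\<lambda>_. borel))"
        using I[OF p] by (intro borel_measurable_sum) auto
      then show ?thesis by measurable
    qed
    have "?e p \<omega> = iexp (t * (\<Sum>i\<in>I p. f i ((\<lambda>i\<in>J. T i \<omega>) i)))" for \<omega>
      using I[OF p] unfolding X_def by (intro arg_cong[where f = "\<lambda>y. iexp (t * y)"] sum.cong) auto
    then have "indep_var borel (?in p) borel (?e p)"
      using indep_var_compose_indep_rv[OF \<sigma>T, of "indicator {p}" borel, OF _ g] by simp
    then show "integrable M (\<lambda>\<omega>. ?in p \<omega> * ?e p \<omega>)"
      "(LINT \<omega>|M. ?in p \<omega> * ?e p \<omega>) = (LINT \<omega>|M. ?in p \<omega>) * (LINT \<omega>|M. ?e p \<omega>)"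
      using in_int e_int[OF p] by (auto intro: indep_var_integrable indep_var_lebesgue_integral)
  qed
  have in_eq: "(LINT \<omega>|M. ?in p \<omega>) = of_real (measure (distr M (count_space S) \<sigma>) {p})" if "p \<in> S" for p
  proof -
    let ?A = "\<sigma> -` {p} \<inter> space M"
    have A: "?A \<in> sets M" using \<sigma> that by (auto intro: measurable_sets)
    have "(LINT \<omega>|M. ?in p \<omega>) = (LINT \<omega>|M. complex_of_real (indicator ?A \<omega>))"
      by (intro Bochner_Integration.integral_cong) (auto split: split_indicator)
    also have "\<dots> = of_real (LINT \<omega>|M. indicator ?A \<omega>)"
      by (rule integral_complex_of_real)
    also have "\<dots> = of_real (measure (distr M (count_space S) \<sigma>) {p})"
      using A that by (simp add: measure_distr)
    finally show ?thesis .
  qed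
  have e_eq: "(LINT \<omega>|M. ?e p \<omega>) = char \<nu> t ^ card (I p)" if p: "p \<in> S" for p
  proof -
    have "(LINT \<omega>|M. ?e p \<omega>) = char (distr M borel (X p)) t"
      using X_meas[OF p] by (simp add: char_def integral_distr)
    also have "\<dots> = char (distr M borel (\<lambda>\<omega>. \<Sum>i\<in>I p. f i (T i \<omega>))) t"
      by (simp add: X_def[abs_def])
    also have "\<dots> = (\<Prod>i\<in>I p. char (distr M borel (\<lambda>\<omega>. f i (T i \<omega>))) t)"
    proof (rule char_distr_sum)
      show "indep_vars (\<lambda>_. borel) (\<lambda>i \<omega>. f i (T i \<omega>)) (I p)"
        by (rule indep_vars_compose2[OF indep_vars_subset[OF T I[OF p]]]) (use f I[OF p] in auto)
    qed
    also have "\<dots> = (\<Prod>i\<in>I p. char \<nu> t)"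
      using I[OF p] \<nu> by (intro prod.cong) auto
    finally show ?thesis by simp
  qed
  have "char (distr M borel (\<lambda>\<omega>. X (\<sigma> \<omega>) \<omega>)) t = (LINT \<omega>|M. ?e (\<sigma> \<omega>) \<omega>)"
    using meas by (simp add: char_def integral_distr X_def)
  also have "\<dots> = (LINT \<omega>|M. (\<Sum>p\<in>S. ?in p \<omega> * ?e p \<omega>))"
  proof (rule Bochner_Integration.integral_cong[OF refl])
    fix \<omega> assume "\<omega> \<in> space M"
    then have "\<sigma> \<omega> \<in> S" using measurable_space[OF \<sigma>] by simp
    then have "(\<Sum>p\<in>S. ?in p \<omega> * ?e p \<omega>) = (\<Sum>p\<in>{\<sigma> \<omega>}. ?in p \<omega> * ?e p \<omega>)"
      using S by (intro sum.mono_neutral_right) (auto split: split_indicator)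
    then show "?e (\<sigma> \<omega>) \<omega> = (\<Sum>p\<in>S. ?in p \<omega> * ?e p \<omega>)" by simp
  qed
  also have "\<dots> = (\<Sum>p\<in>S. (LINT \<omega>|M. ?in p \<omega> * ?e p \<omega>))"
    using prod_int by (rule Bochner_Integration.integral_sum)
  also have "\<dots> = (\<Sum>p\<in>S. of_real (measure (distr M (count_space S) \<sigma>) {p}) * char \<nu> t ^ card (I p))"
    by (intro sum.cong refl) (simp only: prod_eq in_eq e_eq)
  finally show "char (distr M borel (\<lambda>\<omega>. \<Sum>i\<in>I (\<sigma> \<omega>). f i (T i \<omega>))) t =
      (\<Sum>p\<in>S. of_real (measure (distr M (count_space S) \<sigma>) {p}) * char \<nu> t ^ card (I p))"
    by (simp add: X_def)
qed

section \<open>The logarithm of the characteristic polynomial\<close>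

lemma measure_ewens:
  assumes "\<theta> > 0" "p permutes {1..n}"
  shows "measure (ewens_measure \<theta> n) {p} = \<theta> ^ num_cycles n p / pochhammer \<theta> n"
proof -
  have "finite {p. p permutes {1..n}}" by (intro finite_permutations) auto
  then show ?thesis
    unfolding ewens_measure_def using assms
    by (subst measure_point_measure_finite_if) (auto intro!: divide_nonneg_nonneg pochhammer_nonneg)
qed

lemma sum_num_cycles_of_length:
  assumes "p permutes {1..n}"
  shows "(\<Sum>m\<in>{1..n}. num_cycles_of_length n m p) = num_cycles n p"
proof -
  let ?C = "perm_cycles n p"
  have fin: "finite ?C" by (simp add: perm_cycles_def)
  have "card ` ?C \<subseteq> {1..n}"
  proof
    fix m assume "m \<in> card ` ?C"
    then obtain c where c: "c \<in> {1..n}" and m: "m = card (orbit p c)" by (auto simp: perm_cycles_def)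
    have sub: "orbit p c \<subseteq> {1..n}" by (rule orbit_subset_carrier[OF assms c])
    then have "card (orbit p c) \<le> n" using card_mono[OF _ sub] by simp
    moreover have "card (orbit p c) \<noteq> 0"
      using orbit_nonempty[of p c] finite_subset[OF sub] by simp
    ultimately show "m \<in> {1..n}" using m by simp
  qed
  then have "(\<Sum>m\<in>{1..n}. \<Sum>c | c \<in> ?C \<and> card c = m. 1::nat) = (\<Sum>c\<in>?C. 1)"
    using fin by (intro sum.group) auto
  then show ?thesis by (simp add: num_cycles_of_length_def num_cycles_def)
qed

text \<open>
  Every cycle contributes an independent copy of \<open>\<phi> (Ln (1 - u))\<close> with \<open>u\<close> uniform,
  irrespective of its length: \<open>T m k\<close> is uniform, and so is its rotation by a power of \<open>x\<close>.
  The characteristic function is thus the mean of the \<open>K\<close>-th power of a number, where \<open>K\<close> is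
  the number of cycles, and the generating function of \<open>K\<close> evaluates it.
\<close>
lemma char_log_Z_component:
  fixes \<theta> t :: real and x :: complex and N :: "'a measure" and \<phi> :: "complex \<Rightarrow> real"
    and \<sigma> :: "'a \<Rightarrow> nat \<Rightarrow> nat" and T :: "nat \<Rightarrow> nat \<Rightarrow> 'a \<Rightarrow> complex"
  assumes \<theta>: "\<theta> > 0" and x: "norm x = 1" and N: "prob_space N"
    and \<sigma>: "distr N (count_space {p. p permutes {1..n}}) \<sigma> = ewens_measure \<theta> n"
    and T: "prob_space.indep_vars N (\<lambda>_. borel) (\<lambda>(m, k). T m k) ({1..} \<times> {1..})"
    and T_law: "\<And>m k. m \<ge> 1 \<Longrightarrow> k \<ge> 1 \<Longrightarrow> distr N borel (T m k) = uniform_circle"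
    and \<sigma>T: "indep_rv N (count_space {p. p permutes {1..n}}) \<sigma>
      (Pi\<^sub>M ({1..} \<times> {1..}) (\<lambda>_. borel)) (\<lambda>\<omega>. \<lambda>(m, k)\<in>{1..} \<times> {1..}. T m k \<omega>)"
    and \<phi>: "bounded_linear \<phi>"
  shows "(\<lambda>\<omega>. \<phi> (log_Z n x (\<sigma> \<omega>) (\<lambda>m k. T m k \<omega>))) \<in> borel_measurable N"
    and "char (distr N borel (\<lambda>\<omega>. \<phi> (log_Z n x (\<sigma> \<omega>) (\<lambda>m k. T m k \<omega>)))) t =
      pochhammer (of_real \<theta> * char (distr uniform_circle borel (\<lambda>u. \<phi> (Ln (1 - u)))) t) n / pochhammer (of_real \<theta>) n"
proof -
  interpret prob_space N by fact
  have [measurable]: "\<phi> \<in> borel_measurable borel"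
    by (intro borel_measurable_continuous_onI linear_continuous_on \<phi>)
  define S where "S = {p. p permutes {1..n}}"
  define J :: "(nat \<times> nat) set" where "J = {1..} \<times> {1..}"
  define I where "I p = (SIGMA m:{1..n}. {1..num_cycles_of_length n m p})" for p
  define T' where "T' = (\<lambda>(m, k). T m k)"
  define f where "f i u = \<phi> (Ln (1 - x powi (- int (fst i)) * u))" for i :: "nat \<times> nat" and u
  let ?\<nu> = "distr uniform_circle borel (\<lambda>u. \<phi> (Ln (1 - u)))"
  have S: "finite S" unfolding S_def by (intro finite_permutations) auto
  have f_meas: "f i \<in> borel_measurable borel" for i
    unfolding f_def by measurable
  have T': "indep_vars (\<lambda>_. borel) T' J" using T by (simp add: T'_def J_def)
  have T'_meas: "T' i \<in> borel_measurable N" if "i \<in> J" for i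
    using T' that by (simp add: indep_vars_def)
  have \<nu>: "distr N borel (\<lambda>\<omega>. f i (T' i \<omega>)) = ?\<nu>" if i: "i \<in> J" for i
  proof -
    let ?c = "x powi (- int (fst i))"
    have "norm ?c = 1" using x by (simp add: norm_power_int)
    have "distr N borel (\<lambda>\<omega>. f i (T' i \<omega>)) = distr (distr N borel (T' i)) borel (f i)"
      using T'_meas[OF i] f_meas by (subst distr_distr) (auto simp: comp_def)
    also have "distr N borel (T' i) = uniform_circle"
      using i T_law by (auto simp: T'_def J_def)
    also have "distr uniform_circle borel (f i) =
        distr (distr uniform_circle borel (\<lambda>u. ?c * u)) borel (\<lambda>u. \<phi> (Ln (1 - u)))"
    proof -
      have "f i = (\<lambda>u. \<phi> (Ln (1 - ?c * u)))" by (simp add: f_def fun_eq_iff)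
      then show ?thesis by (subst distr_distr) (auto simp: comp_def)
    qed
    also have "distr uniform_circle borel (\<lambda>u. ?c * u) = uniform_circle"
      by (rule distr_uniform_circle_rotate) fact
    finally show ?thesis .
  qed
  have \<sigma>T': "indep_rv N (count_space S) \<sigma> (Pi\<^sub>M J (\<lambda>_. borel)) (\<lambda>\<omega>. \<lambda>i\<in>J. T' i \<omega>)"
  proof -
    have "(\<lambda>\<omega>. \<lambda>i\<in>J. T' i \<omega>) = (\<lambda>\<omega>. \<lambda>(m, k)\<in>J. T m k \<omega>)"
      by (auto simp: T'_def restrict_def fun_eq_iff split: prod.split)
    then show ?thesis using \<sigma>T unfolding S_def J_def by (simp only:)
  qed
  have IJ: "I p \<subseteq> J" for p by (auto simp: I_def J_def)
  note main = char_sum_random_index_set[OF S \<sigma>T' T' f_meas \<nu> IJ]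
  have eq: "\<phi> (log_Z n x (\<sigma> \<omega>) (\<lambda>m k. T m k \<omega>)) = (\<Sum>i\<in>I (\<sigma> \<omega>). f i (T' i \<omega>))" for \<omega>
    unfolding log_Z_def I_def f_def T'_def
    by (simp add: linear_sum[OF bounded_linear.linear[OF \<phi>]] sum.Sigma case_prod_beta)
  show "(\<lambda>\<omega>. \<phi> (log_Z n x (\<sigma> \<omega>) (\<lambda>m k. T m k \<omega>))) \<in> borel_measurable N"
    unfolding eq by (rule main(1))
  let ?w = "of_real \<theta> * char ?\<nu> t"
  have "char (distr N borel (\<lambda>\<omega>. \<phi> (log_Z n x (\<sigma> \<omega>) (\<lambda>m k. T m k \<omega>)))) t =
      (\<Sum>p\<in>S. of_real (measure (ewens_measure \<theta> n) {p}) * char ?\<nu> t ^ card (I p))"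
    unfolding eq \<sigma>[folded S_def, symmetric] by (rule main(2))
  also have "\<dots> = (\<Sum>p\<in>S. ?w ^ card (orbit p ` {1..n}) / pochhammer (of_real \<theta>) n)"
  proof (rule sum.cong[OF refl])
    fix p assume "p \<in> S"
    then have p: "p permutes {1..n}" by (simp add: S_def)
    have "card (I p) = num_cycles n p"
      unfolding I_def using sum_num_cycles_of_length[OF p] by simp
    then show "of_real (measure (ewens_measure \<theta> n) {p}) * char ?\<nu> t ^ card (I p) =
        ?w ^ card (orbit p ` {1..n}) / pochhammer (of_real \<theta>) n"
      using measure_ewens[OF \<theta> p]
      by (simp add: num_cycles_def perm_cycles_def power_mult_distrib pochhammer_of_real)
  qed
  also have "\<dots> = (\<Sum>p\<in>S. ?w ^ card (orbit p ` {1..n})) / pochhammer (of_real \<theta>) n"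
    by (rule sum_divide_distrib[symmetric])
  also have "(\<Sum>p\<in>S. ?w ^ card (orbit p ` {1..n})) = pochhammer ?w n"
    unfolding S_def using sum_power_card_orbits[of "{1..n}" ?w] by simp
  finally show "char (distr N borel (\<lambda>\<omega>. \<phi> (log_Z n x (\<sigma> \<omega>) (\<lambda>m k. T m k \<omega>)))) t =
      pochhammer ?w n / pochhammer (of_real \<theta>) n" .
qed

text \<open>
  Serves to discard the measure with index 0, about which nothing is assumed in the limit
  theorem.
\<close>
lemma weak_conv_m_Suc:
  assumes "weak_conv_m (\<lambda>n. D (Suc n)) D'"
  shows "weak_conv_m D D'"
  using assms unfolding weak_conv_m_def weak_conv_def by (auto intro: LIMSEQ_imp_Suc)

text \<open>
  Stated for a real linear functional \<open>\<phi>\<close>, so that it covers the real and the imaginary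
  part at once. At the argument \<open>t / s\<close>, with \<open>s\<^sup>2 = v \<theta> ln n\<close>, the characteristic function of
  one summand is \<open>1 - t\<^sup>2 / (2 \<theta> ln n)\<close> to leading order. This is precisely the
  scale on which the quotient of rising factorials converges, with limit
  \<open>exp (- t\<^sup>2 / 2)\<close>.
\<close>
lemma log_Z_component_clt:
  fixes \<theta> :: real and x :: complex and M :: "nat \<Rightarrow> 'a measure" and \<phi> :: "complex \<Rightarrow> real"
    and \<sigma> :: "nat \<Rightarrow> 'a \<Rightarrow> (nat \<Rightarrow> nat)" and T :: "nat \<Rightarrow> nat \<Rightarrow> nat \<Rightarrow> 'a \<Rightarrow> complex"
  assumes \<theta>: "\<theta> > 0" and x: "norm x = 1" and M: "\<And>n. n \<ge> 1 \<Longrightarrow> prob_space (M n)"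
    and \<sigma>: "\<And>n. n \<ge> 1 \<Longrightarrow> distr (M n) (count_space {p. p permutes {1..n}}) (\<sigma> n) = ewens_measure \<theta> n"
    and T: "\<And>n. n \<ge> 1 \<Longrightarrow>
      prob_space.indep_vars (M n) (\<lambda>_. borel) (\<lambda>(m, k). T n m k) ({1..} \<times> {1..})"
    and T_law: "\<And>n m k. n \<ge> 1 \<Longrightarrow> m \<ge> 1 \<Longrightarrow> k \<ge> 1 \<Longrightarrow> distr (M n) borel (T n m k) = uniform_circle"
    and \<sigma>T: "\<And>n. n \<ge> 1 \<Longrightarrow> indep_rv (M n) (count_space {p. p permutes {1..n}}) (\<sigma> n)
      (Pi\<^sub>M ({1..} \<times> {1..}) (\<lambda>_. borel)) (\<lambda>\<omega>. \<lambda>(m, k)\<in>{1..} \<times> {1..}. T n m k \<omega>)"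
    and \<phi>: "bounded_linear \<phi>"
    and \<phi>2: "integrable uniform_circle (\<lambda>u. (\<phi> (Ln (1 - u)))\<^sup>2)"
    and mean: "(LINT u|uniform_circle. \<phi> (Ln (1 - u))) = 0"
    and var: "(LINT u|uniform_circle. (\<phi> (Ln (1 - u)))\<^sup>2) = v" and v: "v > 0"
  shows "weak_conv_m
      (\<lambda>n. distr (M n) borel (\<lambda>\<omega>. \<phi> (log_Z n x (\<sigma> n \<omega>) (\<lambda>m k. T n m k \<omega>)) / sqrt (v * \<theta> * ln (real n))))
      std_normal_distribution"
proof -
  have \<phi>_meas [measurable]: "\<phi> \<in> borel_measurable borel"
    by (intro borel_measurable_continuous_onI linear_continuous_on \<phi>)
  define X where "X n \<omega> = \<phi> (log_Z n x (\<sigma> n \<omega>) (\<lambda>m k. T n m k \<omega>))" for n \<omega>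
  define s where "s n = sqrt (v * \<theta> * ln (real n))" for n
  define \<nu> where "\<nu> = distr uniform_circle borel (\<lambda>u. \<phi> (Ln (1 - u)))"
  note char_X = char_log_Z_component[OF \<theta> x M \<sigma> T T_law \<sigma>T \<phi>, folded X_def \<nu>_def]
  have \<phi>1: "integrable uniform_circle (\<lambda>u. \<phi> (Ln (1 - u)))"
    using \<phi>2 by (rule UC.square_integrable_imp_integrable[rotated]) measurable
  have \<nu>: "real_distribution \<nu>" unfolding \<nu>_def by (rule UC.real_distribution_distr) measurable
  have \<nu>_mom: "integrable \<nu> (\<lambda>x. x)" "integrable \<nu> (\<lambda>x. x\<^sup>2)" "(LINT x|\<nu>. x) = 0" "(LINT x|\<nu>. x\<^sup>2) = v"
    unfolding \<nu>_def using \<phi>1 \<phi>2 mean var by (simp_all add: integrable_distr_eq integral_distr)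
  have lnlim: "filterlim (\<lambda>n. ln (real n)) at_top sequentially"
    by (rule filterlim_compose[OF ln_at_top filterlim_real_sequentially])
  have slim: "filterlim s at_top sequentially"
    unfolding s_def using \<theta> v
    by (intro filterlim_compose[OF sqrt_at_top] filterlim_tendsto_pos_mult_at_top[OF tendsto_const _ lnlim]) auto
  have X_meas: "X n \<in> borel_measurable (M n)" if "n \<ge> 1" for n
    by (rule char_X(1)) (use that in auto)
  have char_lim: "(\<lambda>n. char (distr (M n) borel (\<lambda>\<omega>. X n \<omega> / s n)) t) \<longlonglongrightarrow> char std_normal_distribution t" for t
  proof -
    let ?w = "\<lambda>n. of_real \<theta> * char \<nu> (t / s n)"
    have \<tau>: "(\<lambda>n. t / s n) \<longlonglongrightarrow> 0"
      using slim by (intro tendsto_divide_0[OF tendsto_const] filterlim_at_top_imp_at_infinity)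
    have "eventually (\<lambda>n. t\<^sup>2 / v = \<theta> * ln (real n) * (t / s n)\<^sup>2) sequentially"
      using eventually_gt_at_top[of 1]
    proof eventually_elim
      case (elim n)
      then have "ln (real n) > 0" by simp
      then have "(s n)\<^sup>2 = v * \<theta> * ln (real n)" unfolding s_def using \<theta> v by simp
      then show ?case using \<open>ln (real n) > 0\<close> \<theta> v by (simp add: power_divide)
    qed
    then have "(\<lambda>n. \<theta> * ln (real n) * (t / s n)\<^sup>2) \<longlonglongrightarrow> t\<^sup>2 / v"
      by (rule Lim_transform_eventually[OF tendsto_const])
    from char_second_order_tendsto[OF \<nu> \<nu>_mom \<tau> this]
    have "(\<lambda>n. (?w n - of_real \<theta>) * of_real (ln (real n))) \<longlonglongrightarrow> of_real (- (t\<^sup>2 / v * v / 2))"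
      by (simp add: algebra_simps)
    then have "(\<lambda>n. pochhammer (?w n) n / pochhammer (of_real \<theta>) n) \<longlonglongrightarrow> exp (of_real (- (t\<^sup>2 / v * v / 2)))"
      by (rule pochhammer_quotient_tendsto[OF \<theta>])
    moreover have "exp (complex_of_real (- (t\<^sup>2 / v * v / 2))) = char std_normal_distribution t"
      using v by (simp add: char_std_normal_distribution exp_of_real[symmetric])
    moreover have "eventually (\<lambda>n. pochhammer (?w n) n / pochhammer (of_real \<theta>) n =
        char (distr (M n) borel (\<lambda>\<omega>. X n \<omega> / s n)) t) sequentially"
      using eventually_ge_at_top[of 1]
    proof eventually_elim
      case (elim n)
      have "char (distr (M n) borel (\<lambda>\<omega>. X n \<omega> / s n)) t = char (distr (M n) borel (X n)) (t / s n)"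
        using X_meas[OF elim] by (simp add: char_def integral_distr)
      also have "\<dots> = pochhammer (?w n) n / pochhammer (of_real \<theta>) n"
        by (rule char_X(2)) (use elim in auto)
      finally show ?case by simp
    qed
    ultimately show ?thesis by (auto intro: Lim_transform_eventually)
  qed
  show ?thesis
    unfolding X_def[symmetric] s_def[symmetric]
  proof (rule weak_conv_m_Suc, rule levy_continuity)
    show "real_distribution (distr (M (Suc n)) borel (\<lambda>\<omega>. X (Suc n) \<omega> / s (Suc n)))" for n
      using X_meas[of "Suc n"] by (intro prob_space.real_distribution_distr M) auto
    show "(\<lambda>n. char (distr (M (Suc n)) borel (\<lambda>\<omega>. X (Suc n) \<omega> / s (Suc n))) t) \<longlonglongrightarrow> char std_normal_distribution t" for t
      using LIMSEQ_Suc[OF char_lim] .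
  qed (rule real_dist_normal_dist)
qed

theorem proposition1p1:
  fixes \<theta> :: real and x :: complex
    and P :: "'b measure" and z :: "'b \<Rightarrow> complex"
    and M :: "nat \<Rightarrow> 'a measure"
    and \<sigma> :: "nat \<Rightarrow> 'a \<Rightarrow> (nat \<Rightarrow> nat)"
    and T :: "nat \<Rightarrow> nat \<Rightarrow> nat \<Rightarrow> 'a \<Rightarrow> complex"
  assumes theta: "\<theta> > 0"
    and z_space: "prob_space P"
    and z_meas: "z \<in> borel_measurable P"
    and z_uniform: "distr P borel z = uniform_circle"
    and x_circle: "norm x = 1"
    and x_not_root: "\<And>m :: int. m \<noteq> 0 \<Longrightarrow> x powi m \<noteq> 1"
    and M_space: "\<And>n. n \<ge> 1 \<Longrightarrow> prob_space (M n)"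
    and sigma_meas: "\<And>n. n \<ge> 1 \<Longrightarrow> \<sigma> n \<in> measurable (M n) (count_space {p. p permutes {1..n}})"
    and sigma_law: "\<And>n. n \<ge> 1 \<Longrightarrow>
      distr (M n) (count_space {p. p permutes {1..n}}) (\<sigma> n) = ewens_measure \<theta> n"
    and T_indep: "\<And>n. n \<ge> 1 \<Longrightarrow>
      prob_space.indep_vars (M n) (\<lambda>_. borel) (\<lambda>(m, k). T n m k) ({1..} \<times> {1..})"
    and T_law: "\<And>n m k. n \<ge> 1 \<Longrightarrow> m \<ge> 1 \<Longrightarrow> k \<ge> 1 \<Longrightarrow>
      distr (M n) borel (T n m k) = iid_prod_law m (distr P borel z)"
    and T_sigma_indep: "\<And>n. n \<ge> 1 \<Longrightarrow>
      indep_rv (M n) (count_space {p. p permutes {1..n}}) (\<sigma> n)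
        (Pi\<^sub>M ({1..} \<times> {1..}) (\<lambda>_. borel)) (\<lambda>\<omega>. \<lambda>(m, k)\<in>{1..} \<times> {1..}. T n m k \<omega>)"
  shows "weak_conv_m
           (\<lambda>n. distr (M n) borel
             (\<lambda>\<omega>. Re (log_Z n x (\<sigma> n \<omega>) (\<lambda>m k. T n m k \<omega>)) / sqrt (pi\<^sup>2 / 12 * \<theta> * ln (real n))))
           std_normal_distribution
       \<and> weak_conv_m
           (\<lambda>n. distr (M n) borel
             (\<lambda>\<omega>. Im (log_Z n x (\<sigma> n \<omega>) (\<lambda>m k. T n m k \<omega>)) / sqrt (pi\<^sup>2 / 12 * \<theta> * ln (real n))))
           std_normal_distribution"
proof -
  have T_uniform: "distr (M n) borel (T n m k) = uniform_circle" if "n \<ge> 1" "m \<ge> 1" "k \<ge> 1" for n m k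
    using T_law[OF that] iid_prod_law_uniform_circle[OF that(2)] by (simp add: z_uniform)
  note clt = log_Z_component_clt[OF theta x_circle M_space sigma_law T_indep T_uniform T_sigma_indep]
  show ?thesis
    using clt[OF _ _ _ _ _ _ _ bounded_linear_Re square_integrable_Re_Ln integral_Re_Ln integral_Re_Ln_sq]
      clt[OF _ _ _ _ _ _ _ bounded_linear_Im square_integrable_Im_Ln integral_Im_Ln integral_Im_Ln_sq]
    by simp
qed

end
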